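(* Let $E,F$ be Banach spaces, $\Lambda=B(E,F)\setminus\{0\}$, and for $X\in\Lambda$ let $M(X)=\{T\in B(E,F): T\,N(X)\subset R(X)\}$. Let $\mathcal{F}=\{M(X)\}_{X\in\Lambda}$. If $A\in\Lambda$ is double splitting, then $\mathcal{F}$ is smooth integrable at $A$.
   Context: $B(E,F)$ is the Banach space of bounded linear operators from $E$ to $F$; $N(X)$, $R(X)$ denote kernel and range. $A\in B(E,F)$ is double splitting if $R(A)$ is closed and there are closed subspaces $R^+\subset E$, $N^+\subset F$ with $E=N(A)\oplus R^+$ and $F=R(A)\oplus N^+$. Smooth submanifold: a subset $S$ of a Banach space $G$ is a smooth ($C^\infty$) submanifold if for each $p\in S$ there are a closed complemented subspace $G_0\subset G$, an open neighborhood $W$ of $p$ in $G$, and a $C^\infty$ diffeomorphism $\varphi:W\to\varphi(W)$ onto an open subset of $G$ such that $\varphi(S\cap W)$ is an open set in $G_0$. Smooth integrability: $\mathcal{F}$ is smooth integrable at $A$ if there is a smooth submanifold $S\subset\Lambda$ of $B(E,F)$ with $A\in S$ which is tangent to $M(X)$ at every $X\in S$, i.e. $M(X)=\{\dot c(0): c \text{ a } C^1\text{-curve},\ c(t)\in S,\ c(0)=X\}$ for every $X\in S$. *)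

theory Defs
  imports "HOL-Analysis.Analysis"
begin

text \<open>Banach spaces are real: \<open>'a::banach\<close>.  \<open>B(E,F)\<close> is the library type
  \<open>'a \<Rightarrow>\<^sub>L 'b\<close> with its operator norm.\<close>

definition kernel :: "('a::real_normed_vector \<Rightarrow>\<^sub>L 'b::real_normed_vector) \<Rightarrow> 'a set" where
  "kernel X = {x. blinfun_apply X x = 0}"

definition is_direct_sum :: "'a::real_vector set \<Rightarrow> 'a set \<Rightarrow> bool" where
  "is_direct_sum M N \<longleftrightarrow>
     subspace M \<and> subspace N \<and> M \<inter> N = {0} \<and> {x + y |x y. x \<in> M \<and> y \<in> N} = UNIV"

definition double_splitting :: "('a::real_normed_vector \<Rightarrow>\<^sub>L 'b::real_normed_vector) \<Rightarrow> bool" where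
  "double_splitting A \<longleftrightarrow>
     closed (range (blinfun_apply A)) \<and>
     (\<exists>R. closed R \<and> is_direct_sum (kernel A) R) \<and>
     (\<exists>N. closed N \<and> is_direct_sum (range (blinfun_apply A)) N)"

definition closed_complemented :: "'a::real_normed_vector set \<Rightarrow> bool" where
  "closed_complemented M \<longleftrightarrow> closed M \<and> (\<exists>N. closed N \<and> is_direct_sum M N)"

text \<open>An \<open>n\<close>-linear map is encoded as a function on lists, of which only the values on lists
  of length \<open>n\<close> matter.\<close>

definition bounded_multilinear ::
    "nat \<Rightarrow> ('a::real_normed_vector list \<Rightarrow> 'b::real_normed_vector) \<Rightarrow> bool" where
  "bounded_multilinear n m \<longleftrightarrow>
     (\<forall>us ws. Suc (length us + length ws) = n \<longrightarrow> linear (\<lambda>v. m (us @ v # ws))) \<and>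
     (\<exists>K. \<forall>vs. length vs = n \<longrightarrow> norm (m vs) \<le> K * prod_list (map norm vs))"

text \<open>\<open>f\<close> is \<open>C\<^sup>\<infinity>\<close> on the open set \<open>U\<close> if it has Frechet derivatives of every order.  The iterated
  derivatives live in different types, so they are collected in one family \<open>D\<close> by means of the
  isometry \<open>B(E, B\<^sub>n(E;F)) = B\<^bsub>n+1\<^esub>(E;F)\<close>: for lists of length \<open>n\<close>, the map \<open>D x\<close> is the
  \<open>n\<close>-th derivative at \<open>x\<close>, and the last condition says that \<open>v \<mapsto> (vs \<mapsto> D x (v # vs))\<close>
  is the Frechet derivative at \<open>x\<close> of \<open>D\<close> restricted to lists of length \<open>n\<close>, with respect to the
  norm of \<open>n\<close>-linear maps.  Continuity of all derivatives is then automatic.\<close>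

definition C_infinity_on ::
    "'a::real_normed_vector set \<Rightarrow> ('a \<Rightarrow> 'b::real_normed_vector) \<Rightarrow> bool" where
  "C_infinity_on U f \<longleftrightarrow> open U \<and>
     (\<exists>D :: 'a \<Rightarrow> 'a list \<Rightarrow> 'b.
        (\<forall>x\<in>U. D x [] = f x) \<and>
        (\<forall>n. \<forall>x\<in>U. bounded_multilinear n (D x)) \<and>
        (\<forall>n. \<forall>x\<in>U. \<forall>e>0. \<exists>d>0. \<forall>y\<in>U. norm (y - x) < d \<longrightarrow>
           (\<forall>vs. length vs = n \<longrightarrow>
              norm (D y vs - D x vs - D x ((y - x) # vs))
                \<le> e * norm (y - x) * prod_list (map norm vs))))"

definition C_infinity_diffeomorphism_on ::
    "'a::real_normed_vector set \<Rightarrow> ('a \<Rightarrow> 'b::real_normed_vector) \<Rightarrow> bool" where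
  "C_infinity_diffeomorphism_on W \<phi> \<longleftrightarrow>
     open W \<and> open (\<phi> ` W) \<and> inj_on \<phi> W \<and>
     C_infinity_on W \<phi> \<and> C_infinity_on (\<phi> ` W) (inv_into W \<phi>)"

definition smooth_submanifold :: "'a::real_normed_vector set \<Rightarrow> bool" where
  "smooth_submanifold S \<longleftrightarrow>
     (\<forall>p\<in>S. \<exists>G0 W (\<phi> :: 'a \<Rightarrow> 'a).
        closed_complemented G0 \<and> open W \<and> p \<in> W \<and>
        C_infinity_diffeomorphism_on W \<phi> \<and>
        openin (top_of_set G0) (\<phi> ` (S \<inter> W)))"

definition tangent_set :: "'a::real_normed_vector set \<Rightarrow> 'a \<Rightarrow> 'a set" where
  "tangent_set S X =
     {V. \<exists>(c :: real \<Rightarrow> 'a) r. r > 0 \<and> c C1_differentiable_on {-r<..<r} \<and>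
           (\<forall>t\<in>{-r<..<r}. c t \<in> S) \<and> c 0 = X \<and> (c has_vector_derivative V) (at 0)}"

definition smooth_integrable_at ::
    "'a::real_normed_vector set \<Rightarrow> ('a \<Rightarrow> 'a set) \<Rightarrow> 'a \<Rightarrow> bool" where
  "smooth_integrable_at \<Lambda> M A \<longleftrightarrow>
     (\<exists>S. S \<subseteq> \<Lambda> \<and> smooth_submanifold S \<and> A \<in> S \<and> (\<forall>X\<in>S. M X = tangent_set S X))"

definition M_family ::
    "('a::real_normed_vector \<Rightarrow>\<^sub>L 'b::real_normed_vector) \<Rightarrow> ('a \<Rightarrow>\<^sub>L 'b) set" where
  "M_family X = {T. blinfun_apply T ` kernel X \<subseteq> range (blinfun_apply X)}"

end

theory Submission
  imports Defs
begin

text \<open>The open mapping theorem turns the two splittings of a double splitting \<open>A\<close> into a bounded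
  generalized inverse \<open>B\<close> with \<open>ABA = A\<close> and \<open>BAB = B\<close>.  For \<open>X\<close> close to \<open>A\<close> the compression of
  \<open>X\<close> to a map from \<open>R(B)\<close> to \<open>R(A)\<close> is invertible; let \<open>G(X) : F \<rightarrow> E\<close> be its inverse, extended by
  \<open>0\<close> on \<open>N(B)\<close>.  The submanifold \<open>S\<close> is given by \<open>X - X G(X) X = 0\<close>.  In block form this is the
  vanishing of the Schur complement \<open>d - c a\<^sup>-\<^sup>1 b\<close>, and replacing \<open>d\<close> by the Schur
  complement, which has the inverse \<open>d \<mapsto> d + c a\<^sup>-\<^sup>1 b\<close>, straightens \<open>S\<close>.  For \<open>X \<in> S\<close> both
  \<open>M(X)\<close> and the tangent space are the kernel of \<open>V \<mapsto> (1 - X G(X)) V (1 - G(X) X)\<close>, the derivative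
  of \<open>X - X G(X) X\<close>.\<close>

section \<open>Bounded generalized inverses\<close>

lemma baire_closed_cover:
  fixes B :: "nat \<Rightarrow> 'a::banach set"
  assumes "\<And>n. closed (B n)" and "(\<Union>n. B n) = UNIV"
  obtains n where "interior (B n) \<noteq> {}"
proof (rule ccontr)
  assume "\<not> thesis"
  then have emp: "interior (B n) = {}" for n using that by blast
  have "euclidean interior_of \<Union>(range B) = {}"
  proof (rule Baire_category_alt)
    show "completely_metrizable_space (euclidean :: 'a topology) \<or>
        locally_compact_space (euclidean :: 'a topology) \<and> regular_space (euclidean :: 'a topology)"
      by (simp add: completely_metrizable_space_euclidean)
    show "closedin euclidean T \<and> euclidean interior_of T = {}" if "T \<in> range B" for T
      using that assms(1) emp by (auto simp: interior_of_def interior_def)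
  qed simp
  then show False using assms(2) by (simp add: interior_of_topspace[of euclidean, simplified])
qed

text \<open>The closed sets \<open>B n\<close> cover the target, so by Baire one of them contains a
  ball. Moving that ball to the origin and rescaling gives approximate preimages of all
  vectors.\<close>

lemma approximate_preimage:
  fixes T :: "'a::banach \<Rightarrow>\<^sub>L 'b::banach"
  assumes "subspace C" and "T ` C = UNIV"
  obtains K where "K \<ge> 0" "\<And>y. \<exists>x\<in>C. norm x \<le> K * norm y \<and> norm (y - T x) \<le> norm y / 2"
proof -
  define B where "B n = closure (T ` (C \<inter> cball 0 (real n)))" for n :: nat
  have "(\<Union>n. B n) = UNIV"
  proof -
    have "y \<in> (\<Union>n. B n)" for y
    proof -
      obtain x where x: "x \<in> C" "T x = y" using assms(2) by (metis UNIV_I imageE)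
      obtain n where "norm x \<le> real n" using real_arch_simple by blast
      then have "y \<in> B n" unfolding B_def using x closure_subset by fastforce
      then show ?thesis by blast
    qed
    then show ?thesis by blast
  qed
  moreover have "closed (B n)" for n unfolding B_def by simp
  ultimately obtain n where "interior (B n) \<noteq> {}" using baire_closed_cover by metis
  then obtain y0 r where r: "r > 0" "ball y0 r \<subseteq> B n"
    by (metis ex_in_conv mem_interior)
  have approx: "\<exists>x\<in>C. norm x \<le> real n \<and> norm (T x - y) < e" if "y \<in> B n" "e > 0" for y e
    using that unfolding B_def by (fastforce simp: closure_approachable dist_norm)
  \<comment> \<open>Subtracting approximate preimages of \<open>y0\<close> from those of
    \<open>y0 + y\<close> moves the ball to the origin and doubles the norm bound.\<close>
  have small: "\<exists>x\<in>C. norm x \<le> 2 * real n \<and> norm (y - T x) < e" if y: "norm y < r" "e > 0" for y e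
  proof -
    have "y0 + y \<in> B n" "y0 \<in> B n" using r y by (auto simp: dist_norm)
    then obtain x1 x2 where x1: "x1 \<in> C" "norm x1 \<le> real n" "norm (T x1 - (y0 + y)) < e/2"
      and x2: "x2 \<in> C" "norm x2 \<le> real n" "norm (T x2 - y0) < e/2"
      using approx y by (meson half_gt_zero)
    have "norm (y - T (x1 - x2)) = norm ((T x2 - y0) - (T x1 - (y0 + y)))"
      by (simp add: blinfun.diff_right algebra_simps)
    also have "\<dots> < e" using norm_triangle_ineq4[of "T x2 - y0" "T x1 - (y0 + y)"] x1 x2 by linarith
    finally have "norm (y - T (x1 - x2)) < e" .
    moreover have "norm (x1 - x2) \<le> 2 * real n" using norm_triangle_ineq4[of x1 x2] x1 x2 by
      linarith
    ultimately show ?thesis using subspace_diff[OF assms(1)] x1 x2 by blast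
  qed
  show thesis
  proof
    show "0 \<le> 4 * real n / r" using r by simp
    fix y
    show "\<exists>x\<in>C. norm x \<le> 4 * real n / r * norm y \<and> norm (y - T x) \<le> norm y / 2"
    proof (cases "y = 0")
      case True
      then show ?thesis using subspace_0[OF assms(1)] by (intro bexI[of _ 0]) auto
    next
      case False
      \<comment> \<open>This scale gives \<open>s *\<^sub>R y\<close> the norm \<open>r / 2\<close>,
        so an error of \<open>r / 4\<close> is half of that norm, and the ratio survives the
        division by \<open>s\<close>.\<close>
      define s where "s = r / (2 * norm y)"
      have s: "s > 0" using False r by (simp add: s_def)
      have "norm (s *\<^sub>R y) < r" using False r s by (simp add: s_def)
      then obtain x where x: "x \<in> C" "norm x \<le> 2 * real n" "norm (s *\<^sub>R y - T x) < r / 4"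
        using small[of "s *\<^sub>R y" "r/4"] r by auto
      have "y - T (x /\<^sub>R s) = (s *\<^sub>R y - T x) /\<^sub>R s"
        using s by (simp add: blinfun.scaleR_right scaleR_diff_right)
      then have "norm (y - T (x /\<^sub>R s)) = norm (s *\<^sub>R y - T x) / s"
        using s by (simp add: divide_inverse_commute)
      also have "\<dots> \<le> (r / 4) / s" using x(3) s by (intro divide_right_mono) auto
      also have "\<dots> = norm y / 2" using r by (simp add: s_def)
      finally have "norm (y - T (x /\<^sub>R s)) \<le> norm y / 2" .
      moreover have "norm (x /\<^sub>R s) \<le> 4 * real n / r * norm y"
        using x(2) s False r by (simp add: s_def field_simps)
      ultimately show ?thesis using subspace_scale[OF assms(1) x(1)] by blast
    qed
  qed
qed

text \<open>Successive approximation: the error of the preimage is halved in each step.\<close>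

lemma bounded_preimage:
  fixes T :: "'a::banach \<Rightarrow>\<^sub>L 'b::banach"
  assumes "subspace C" and "closed C" and "T ` C = UNIV"
  obtains K where "\<And>y. \<exists>x\<in>C. T x = y \<and> norm x \<le> K * norm y"
proof -
  obtain K where K: "K \<ge> 0" "\<And>y. \<exists>x\<in>C. norm x \<le> K * norm y \<and> norm (y - T x) \<le> norm y / 2"
    using approximate_preimage[OF assms(1,3)] by blast
  then obtain g where g: "\<And>y. g y \<in> C" "\<And>y. norm (g y) \<le> K * norm y"
      "\<And>y. norm (y - T (g y)) \<le> norm y / 2" by metis
  show thesis
  proof
    fix y
    define r where "r k = ((\<lambda>z. z - T (g z)) ^^ k) y" for k
    have r_Suc: "r (Suc k) = r k - T (g (r k))" for k by (simp add: r_def)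
    have r_le: "norm (r k) \<le> norm y * (1/2) ^ k" for k
    proof (induction k)
      case (Suc k)
      then show ?case using g(3)[of "r k"] by (simp add: r_Suc)
    qed (simp add: r_def)
    have g_le: "norm (g (r k)) \<le> K * norm y * (1/2) ^ k" for k
      using g(2)[of "r k"] mult_left_mono[OF r_le[of k] K(1)] by (simp add: mult.assoc)
    have geo: "(\<lambda>k. K * norm y * (1/2) ^ k) sums (K * norm y * 2)"
      using sums_mult[OF geometric_sums[of "1/2::real"], of "K * norm y"] by simp
    have sumn: "summable (\<lambda>k. norm (g (r k)))"
      by (rule summable_comparison_test'[OF sums_summable[OF geo]]) (use g_le in auto)
    then have sum: "summable (\<lambda>k. g (r k))" by (rule summable_norm_cancel)
    define x where "x = (\<Sum>k. g (r k))"
    have lim: "(\<lambda>k. \<Sum>i<k. g (r i)) \<longlonglongrightarrow> x"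
      using sum by (simp add: x_def summable_LIMSEQ)
    have "x \<in> C"
      by (rule closed_sequentially[OF assms(2) _ lim]) (simp add: subspace_sum[OF assms(1)] g(1))
    moreover have "norm x \<le> K * norm y * 2"
      unfolding x_def using suminf_le[OF g_le sumn sums_summable[OF geo]] summable_norm[OF sumn]
        sums_unique[OF geo] by linarith
    moreover have "T x = y"
    proof -
      \<comment> \<open>The sum telescopes, since
        \<open>T (g (r i)) = r i - r (Suc i)\<close>.\<close>
      have "T (\<Sum>i<k. g (r i)) = y - r k" for k
        by (induction k) (simp_all add: blinfun.zero_right blinfun.add_right r_Suc, simp add: r_def)
      moreover have "(\<lambda>k. T (\<Sum>i<k. g (r i))) \<longlonglongrightarrow> T x"
        by (rule tendsto_intros lim)+
      moreover have "r \<longlonglongrightarrow> 0"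
      proof (rule Lim_null_comparison)
        show "(\<lambda>k. norm y * (1/2) ^ k) \<longlonglongrightarrow> 0"
          by (rule tendsto_mult_right_zero) (simp add: LIMSEQ_realpow_zero)
      qed (use r_le in auto)
      then have "(\<lambda>k. y - r k) \<longlonglongrightarrow> y - 0" by (intro tendsto_intros)
      ultimately show ?thesis using LIMSEQ_unique by fastforce
    qed
    ultimately show "\<exists>x\<in>C. T x = y \<and> norm x \<le> 2 * K * norm y" by (auto simp: mult_ac)
  qed
qed

text \<open>Injectivity on \<open>C\<close> makes the bounded preimage unique, and uniqueness forces
  the choice function \<open>g\<close> to be linear.\<close>

lemma bounded_inverse:
  fixes T :: "'a::banach \<Rightarrow>\<^sub>L 'b::banach"
  assumes "subspace C" and "closed C" and "T ` C = UNIV" and "inj_on T C"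
  obtains J where "\<And>y. blinfun_apply J y \<in> C" "\<And>y. T (blinfun_apply J y) = y"
proof -
  obtain K where "\<And>y. \<exists>x\<in>C. T x = y \<and> norm x \<le> K * norm y"
    using bounded_preimage[OF assms(1-3)] by blast
  then obtain g where g: "\<And>y. g y \<in> C" "\<And>y. T (g y) = y" "\<And>y. norm (g y) \<le> K * norm y" by metis
  have "bounded_linear g"
  proof (rule bounded_linear_intro)
    show "g (x + y) = g x + g y" for x y
      using inj_onD[OF assms(4)] g subspace_add[OF assms(1)] by (metis blinfun.add_right)
    show "g (r *\<^sub>R x) = r *\<^sub>R g x" for r x
      using inj_onD[OF assms(4)] g subspace_scale[OF assms(1)] by (metis blinfun.scaleR_right)
    show "norm (g x) \<le> norm x * K" for x using g(3)[of x] by (simp add: mult.commute)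
  qed
  then show thesis using that[of "Blinfun g"] g by (simp add: bounded_linear_Blinfun_apply)
qed

text \<open>Solving \<open>x + N x = y\<close> is a fixed point problem for the contraction
  \<open>x \<mapsto> y - N x\<close>. So \<open>id_blinfun + N\<close> is bijective, and
  \<open>bounded_inverse\<close> supplies the bounded inverse.\<close>

lemma neumann_inverse:
  fixes N :: "'a::banach \<Rightarrow>\<^sub>L 'a"
  assumes "norm N < 1"
  obtains J where "J o\<^sub>L (id_blinfun + N) = id_blinfun" "(id_blinfun + N) o\<^sub>L J = id_blinfun"
proof -
  let ?T = "id_blinfun + N"
  have ex1: "\<exists>!x. y - N x = x" for y
  proof (rule banach_fix_type)
    have "dist (y - N u) (y - N v) = norm (N (v - u))" for u v
      by (simp add: dist_norm blinfun.diff_right)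
    then show "\<forall>u v. dist (y - N u) (y - N v) \<le> norm N * dist u v"
      using norm_blinfun[of N] by (metis dist_norm dist_commute)
  qed (use assms in auto)
  have eq: "?T x = y \<longleftrightarrow> y - N x = x" for x y
    by (auto simp: blinfun.add_left algebra_simps)
  have "inj ?T" using ex1 eq by (metis injI)
  moreover have "range ?T = UNIV" using ex1 eq by (metis surjI)
  ultimately obtain J where J: "\<And>y. ?T (blinfun_apply J y) = y"
    using bounded_inverse[of UNIV ?T] by (metis closed_UNIV subspace_UNIV)
  show thesis
  proof
    show "?T o\<^sub>L J = id_blinfun" by (rule blinfun_eqI) (simp add: J)
    show "J o\<^sub>L ?T = id_blinfun" by (rule blinfun_eqI) (simp add: injD[OF \<open>inj ?T\<close>] J)
  qed
qed

lemma is_direct_sumD: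
  assumes "is_direct_sum M N"
  shows "subspace M" "subspace N" "M \<inter> N = {0}" "\<exists>x y. z = x + y \<and> x \<in> M \<and> y \<in> N"
proof -
  have "z \<in> {x + y |x y. x \<in> M \<and> y \<in> N}"
    using assms unfolding is_direct_sum_def by simp
  then show "\<exists>x y. z = x + y \<and> x \<in> M \<and> y \<in> N" by blast
qed (use assms in \<open>auto simp: is_direct_sum_def\<close>)

text \<open>The map \<open>(x, n) \<mapsto> A x + n\<close> is a bounded bijection from
  \<open>R \<times> N\<close> onto the target space. The first component of its inverse inverts
  \<open>A\<close> on \<open>R\<close> and vanishes on \<open>N\<close>; this is
  \<open>B\<close>.\<close>

lemma double_splitting_generalized_inverse:
  fixes A :: "'a::banach \<Rightarrow>\<^sub>L 'b::banach"
  assumes "double_splitting A"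
  obtains B where "A o\<^sub>L B o\<^sub>L A = A" "B o\<^sub>L A o\<^sub>L B = B"
proof -
  obtain R N where R: "closed R" "is_direct_sum (kernel A) R"
    and N: "closed N" "is_direct_sum (range A) N"
    using assms unfolding double_splitting_def by blast
  have sR: "subspace R" and iR: "kernel A \<inter> R = {0}" and dR: "\<And>z. \<exists>x y. z = x + y \<and> x \<in> kernel A \<and>
    y \<in> R"
    by (fact is_direct_sumD[OF R(2)])+
  have sN: "subspace N" and iN: "range A \<inter> N = {0}" and dN: "\<And>z. \<exists>x y. z = x + y \<and> x \<in> range A \<and> y
    \<in> N"
    by (fact is_direct_sumD[OF N(2)])+
  have ontoR: "\<exists>x\<in>R. A x = A z" for z
    using dR[of z] unfolding kernel_def by (metis (mono_tags, lifting) add_0 blinfun.add_right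
      mem_Collect_eq)
  define C where "C = R \<times> N"
  define T where "T = (A o\<^sub>L fst_blinfun) + snd_blinfun"
  have T: "T (x, n) = A x + n" for x n by (simp add: T_def blinfun.add_left)
  have "subspace C" unfolding C_def using sR sN by (auto simp: subspace_def zero_prod_def)
  moreover have "closed C" unfolding C_def using R N by (simp add: closed_Times)
  moreover have "T ` C = UNIV"
  proof -
    have "z \<in> T ` C" for z
    proof -
      obtain x n where "z = A x + n" "n \<in> N" using dN[of z] by auto
      moreover obtain x' where "x' \<in> R" "A x' = A x" using ontoR by blast
      ultimately have "z = T (x', n)" "(x', n) \<in> C" by (auto simp: T C_def)
      then show ?thesis by blast
    qed
    then show ?thesis by blast
  qed
  moreover have inj: "x = x' \<and> n = n'" if "x \<in> R" "x' \<in> R" "n \<in> N" "n' \<in> N" "A x + n = A x' + n'"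
    for x x' n n'
  proof -
    have "A (x - x') = n' - n" using that(5) by (simp add: blinfun.diff_right algebra_simps)
    moreover have "n' - n \<in> N" using subspace_diff[OF sN] that by blast
    ultimately have 0: "A (x - x') = 0" "n' - n = 0" using iN by (metis IntI rangeI singletonD)+
    then have "x - x' \<in> kernel A \<inter> R" using subspace_diff[OF sR] that by (simp add: kernel_def)
    then have "x - x' = 0" using iR by simp
    then show ?thesis using 0 by simp
  qed
  then have "inj_on T C" unfolding C_def by (auto simp: inj_on_def T)
  ultimately obtain J where J: "\<And>y. blinfun_apply J y \<in> C" "\<And>y. T (blinfun_apply J y) = y"
    using bounded_inverse by metis
  have J_in: "fst (J y) \<in> R" "snd (J y) \<in> N" and J_eq: "A (fst (J y)) + snd (J y) = y" for y
    using J[of y] by (auto simp: C_def T_def blinfun.add_left)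
  define B where "B = fst_blinfun o\<^sub>L J"
  have B: "B y = fst (J y)" for y by (simp add: B_def)
  have fst_J: "fst (J (A x)) = x" if "x \<in> R" for x
    using inj[of "fst (J (A x))" x "snd (J (A x))" 0] that J_in J_eq subspace_0[OF sN] by simp
  show thesis
  proof
    show "A o\<^sub>L B o\<^sub>L A = A"
    proof (rule blinfun_eqI)
      fix z
      obtain x where x: "x \<in> R" "A x = A z" using ontoR by blast
      then show "(A o\<^sub>L B o\<^sub>L A) z = A z" using fst_J[OF x(1)] by (simp add: B)
    qed
    show "B o\<^sub>L A o\<^sub>L B = B"
      by (rule blinfun_eqI) (simp add: B fst_J[OF J_in(1)])
  qed
qed

section \<open>Infinitely differentiable maps\<close>

primrec insert_sum :: "'a \<Rightarrow> ('a list \<Rightarrow> 'b::comm_monoid_add) \<Rightarrow> 'a list \<Rightarrow> 'b" where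
  "insert_sum v m [] = m [v]"
| "insert_sum v m (w # ws) = m (v # w # ws) + insert_sum v (\<lambda>q. m (w # q)) ws"

text \<open>Iterated insertion runs through all orders of the list. The head is inserted into
  \<open>m\<close> before the tail is treated, so \<open>perm_sum (m x) ((y - x) # vs)\<close> is
  the permutation sum over \<open>vs\<close> of the insertion of \<open>y - x\<close>, which is the
  form in which the derivative condition presents it.\<close>

primrec perm_sum :: "('a list \<Rightarrow> 'b::comm_monoid_add) \<Rightarrow> 'a list \<Rightarrow> 'b" where
  "perm_sum m [] = m []"
| "perm_sum m (v # vs) = perm_sum (insert_sum v m) vs"

lemma insert_sum_linear_image:
  assumes "linear L"
  shows "insert_sum v (\<lambda>q. L (m q)) ws = L (insert_sum v m ws)"
  by (induction ws arbitrary: m) (simp_all add: linear_add[OF assms])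

lemma insert_sum_diff:
  fixes m m' :: "'a list \<Rightarrow> 'b::ab_group_add"
  shows "insert_sum v (\<lambda>q. m q - m' q) ws = insert_sum v m ws - insert_sum v m' ws"
  by (induction ws arbitrary: m m') simp_all

lemma perm_sum_diff:
  fixes m m' :: "'a list \<Rightarrow> 'b::ab_group_add"
  shows "perm_sum (\<lambda>q. m q - m' q) vs = perm_sum m vs - perm_sum m' vs"
  by (induction vs arbitrary: m m') (simp_all add: insert_sum_diff[abs_def])

lemma insert_sum_linear:
  assumes "\<And>q. linear (\<lambda>t. m t q)"
  shows "linear (\<lambda>t. insert_sum v (m t) ws)"
  using assms by (induction ws arbitrary: m) (simp_all add: linear_compose_add)

lemma perm_sum_linear:
  assumes "\<And>q. linear (\<lambda>t. m t q)"
  shows "linear (\<lambda>t. perm_sum (m t) vs)"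
  using assms by (induction vs arbitrary: m) (simp_all add: insert_sum_linear)

lemma insert_sum_linear_arg:
  assumes "\<And>us ws. linear (\<lambda>v. m (us @ v # ws))"
  shows "linear (\<lambda>v. insert_sum v m ws)"
  using assms
proof (induction ws arbitrary: m)
  case Nil
  then show ?case using Nil[of "[]" "[]"] by simp
next
  case (Cons w ws)
  have "linear (\<lambda>v. insert_sum v (\<lambda>q. m (w # q)) ws)"
    by (rule Cons.IH) (use Cons.prems[of "w # _"] in simp)
  then show ?case using Cons.prems[of "[]"] by (simp add: linear_compose_add)
qed

text \<open>Here the varying entry belongs to the list, not to the inserted vector. Once the
  insertion point has passed \<open>v\<close>, that entry is a mere parameter of the inner function,
  and \<open>insert_sum_linear\<close> applies.\<close>

lemma insert_sum_multilinear:
  assumes "\<And>us ws. linear (\<lambda>v. m (us @ v # ws))"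
  shows "linear (\<lambda>v. insert_sum u m (us @ v # ws))"
  using assms
proof (induction us arbitrary: m)
  case Nil
  have "linear (\<lambda>v. insert_sum u (\<lambda>q. m (v # q)) ws)"
    by (rule insert_sum_linear) (use Nil[of "[]"] in simp)
  then show ?case using Nil[of "[u]"] by (simp add: linear_compose_add)
next
  case (Cons w us)
  have "linear (\<lambda>v. insert_sum u (\<lambda>q. m (w # q)) (us @ v # ws))"
    by (rule Cons.IH) (use Cons.prems[of "w # _"] in simp)
  then show ?case using Cons.prems[of "u # w # us"] by (simp add: linear_compose_add)
qed

lemma perm_sum_multilinear:
  assumes "\<And>us ws. linear (\<lambda>v. m (us @ v # ws))"
  shows "linear (\<lambda>v. perm_sum m (us @ v # ws))"
  using assms
proof (induction us arbitrary: m)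
  case Nil
  then show ?case by (simp add: perm_sum_linear insert_sum_linear_arg)
next
  case (Cons u us)
  then show ?case by (simp add: insert_sum_multilinear)
qed

lemma insert_sum_bound:
  assumes "\<And>q. length q = Suc (length ws) \<Longrightarrow> norm (m q) \<le> K * prod_list (map norm q)"
  shows "norm (insert_sum v m ws) \<le> real (Suc (length ws)) * K * norm v * prod_list (map norm ws)"
  using assms
proof (induction ws arbitrary: m K)
  case Nil
  then show ?case using Nil[of "[v]"] by simp
next
  case (Cons w ws)
  have "norm (insert_sum v (\<lambda>q. m (w # q)) ws)
      \<le> real (Suc (length ws)) * (K * norm w) * norm v * prod_list (map norm ws)"
    by (rule Cons.IH) (use Cons.prems[of "w # _"] in \<open>simp add: mult_ac\<close>)
  moreover have "norm (m (v # w # ws)) \<le> K * (norm v * (norm w * prod_list (map norm ws)))"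
    using Cons.prems[of "v # w # ws"] by simp
  ultimately show ?case
    using norm_triangle_ineq[of "m (v # w # ws)" "insert_sum v (\<lambda>q. m (w # q)) ws"]
    by (simp add: algebra_simps)
qed

text \<open>The factorial counts the orders; each induction step contributes the number of positions
  from \<open>insert_sum_bound\<close>.\<close>

lemma perm_sum_bound:
  assumes "\<And>q. length q = length vs \<Longrightarrow> norm (m q) \<le> K * prod_list (map norm q)"
  shows "norm (perm_sum m vs) \<le> fact (length vs) * K * prod_list (map norm vs)"
  using assms
proof (induction vs arbitrary: m K)
  case Nil
  then show ?case using Nil[of "[]"] by simp
next
  case (Cons v vs)
  have "norm (perm_sum (insert_sum v m) vs)
      \<le> fact (length vs) * (real (Suc (length vs)) * K * norm v) * prod_list (map norm vs)"
  proof (rule Cons.IH)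
    fix q :: "'a list" assume "length q = length vs"
    then show "norm (insert_sum v m q)
        \<le> real (Suc (length vs)) * K * norm v * prod_list (map norm q)"
      using insert_sum_bound[of q m K v] Cons.prems by simp
  qed
  then show ?case by (simp add: algebra_simps)
qed

lemma prod_list_norm_nonneg: "0 \<le> prod_list (map norm vs)"
  by (induction vs) simp_all

text \<open>The \<open>n\<close>-th derivative of \<open>f\<close> is the sum of \<open>m x\<close> over all orders of the \<open>n\<close> directions;
  differentiating a summand inserts the new direction at every possible position.\<close>

lemma C_infinity_on_perm_sumI:
  assumes "open U" and "\<And>x. x \<in> U \<Longrightarrow> m x [] = f x"
    and lin: "\<And>x us ws. x \<in> U \<Longrightarrow> linear (\<lambda>v. m x (us @ v # ws))"
    and bound: "\<And>x n. x \<in> U \<Longrightarrow>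
      \<exists>K. \<forall>vs. length vs = n \<longrightarrow> norm (m x vs) \<le> K * prod_list (map norm vs)"
    and deriv: "\<And>x n. x \<in> U \<Longrightarrow> \<exists>K. \<forall>\<^sub>F y in nhds x. \<forall>vs. length vs = n \<longrightarrow>
      norm (m y vs - m x vs - insert_sum (y - x) (m x) vs)
        \<le> K * (norm (y - x))\<^sup>2 * prod_list (map norm vs)"
  shows "C_infinity_on U f"
  unfolding C_infinity_on_def
proof (intro conjI exI[of _ "\<lambda>x. perm_sum (m x)"] ballI allI impI)
  fix n x assume x: "x \<in> U"
  obtain K where K: "\<And>vs. length vs = n \<Longrightarrow> norm (m x vs) \<le> K * prod_list (map norm vs)"
    using bound[OF x] by blast
  have "norm (perm_sum (m x) vs) \<le> fact n * K * prod_list (map norm vs)" if "length vs = n" for vs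
    using perm_sum_bound[of vs "m x" K] K that by simp
  then show "bounded_multilinear n (perm_sum (m x))"
    unfolding bounded_multilinear_def using perm_sum_multilinear[of "m x"] lin[OF x] by blast
next
  fix n x and e :: real assume x: "x \<in> U" and e: "e > 0"
  obtain K d where d: "d > 0" and K: "\<And>y vs. dist y x < d \<Longrightarrow> length vs = n \<Longrightarrow>
      norm (m y vs - m x vs - insert_sum (y - x) (m x) vs)
        \<le> K * (norm (y - x))\<^sup>2 * prod_list (map norm vs)"
    using deriv[OF x, of n] unfolding eventually_nhds_metric by blast
  \<comment> \<open>Symmetrizing the remainder of \<open>m\<close> multiplies its constant by at
    most \<open>fact n\<close>. The summand 1 makes \<open>L\<close> positive, so that
    \<open>e / L\<close> is a radius; within it the factor \<open>L * norm (y - x)\<close> is at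
    most \<open>e\<close>.\<close>
  define L where "L = fact n * \<bar>K\<bar> + 1"
  have L: "L > 0" unfolding L_def by (simp add: add_nonneg_pos)
  show "\<exists>d>0. \<forall>y\<in>U. norm (y - x) < d \<longrightarrow> (\<forall>vs. length vs = n \<longrightarrow>
      norm (perm_sum (m y) vs - perm_sum (m x) vs - perm_sum (m x) ((y - x) # vs))
        \<le> e * norm (y - x) * prod_list (map norm vs))"
  proof (intro exI[of _ "min d (e / L)"] conjI ballI allI impI)
    fix y and vs :: "'a list" assume y: "norm (y - x) < min d (e / L)" and n: "length vs = n"
    let ?h = "norm (y - x)" and ?\<pi> = "prod_list (map norm vs)"
    have "norm (perm_sum (\<lambda>q. m y q - m x q - insert_sum (y - x) (m x) q) vs)
        \<le> fact (length vs) * (K * ?h\<^sup>2) * ?\<pi>"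
      by (rule perm_sum_bound) (use K y n in \<open>simp add: dist_norm\<close>)
    also have "\<dots> \<le> (L * ?h) * ?h * ?\<pi>"
    proof -
      have "fact n * K * ?h\<^sup>2 \<le> L * ?h\<^sup>2"
        by (intro mult_right_mono) (auto simp: L_def intro: add_increasing2 mult_left_mono)
      then show ?thesis
        by (intro mult_right_mono) (auto simp: n power2_eq_square mult_ac prod_list_norm_nonneg)
    qed
    also have "\<dots> \<le> e * ?h * ?\<pi>"
      using y L by (intro mult_right_mono) (auto simp: field_simps prod_list_norm_nonneg)
    finally show "norm (perm_sum (m y) vs - perm_sum (m x) vs - perm_sum (m x) ((y - x) # vs))
        \<le> e * ?h * ?\<pi>" by (simp add: perm_sum_diff)
  qed (use d e L in auto)
qed (use assms in auto)

section \<open>Sums, linear images and linear maps\<close>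

lemma C_infinity_on_cong:
  assumes "C_infinity_on U f" and "\<And>x. x \<in> U \<Longrightarrow> f x = g x"
  shows "C_infinity_on U g"
  using assms unfolding C_infinity_on_def by simp

lemma C_infinity_onE:
  assumes "C_infinity_on U f"
  obtains D where "open U" "\<forall>x\<in>U. D x [] = f x"
    "\<forall>n. \<forall>x\<in>U. bounded_multilinear n (D x)"
    "\<forall>n. \<forall>x\<in>U. \<forall>e>0. \<exists>d>0. \<forall>y\<in>U. norm (y - x) < d \<longrightarrow> (\<forall>vs. length vs = n \<longrightarrow>
      norm (D y vs - D x vs - D x ((y - x) # vs)) \<le> e * norm (y - x) * prod_list (map norm vs))"
  using assms unfolding C_infinity_on_def by (elim conjE exE) (rule that)

lemma bounded_multilinear_add:
  assumes "bounded_multilinear n m" and "bounded_multilinear n m'"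
  shows "bounded_multilinear n (\<lambda>vs. m vs + m' vs)"
  unfolding bounded_multilinear_def
proof (intro conjI allI impI)
  show "linear (\<lambda>v. m (us @ v # ws) + m' (us @ v # ws))" if "Suc (length us + length ws) = n" for
    us ws
    using assms that unfolding bounded_multilinear_def by (intro linear_compose_add) auto
  obtain K K' where "\<And>vs. length vs = n \<Longrightarrow> norm (m vs) \<le> K * prod_list (map norm vs)"
    "\<And>vs. length vs = n \<Longrightarrow> norm (m' vs) \<le> K' * prod_list (map norm vs)"
    using assms unfolding bounded_multilinear_def by blast
  then have "norm (m vs + m' vs) \<le> (K + K') * prod_list (map norm vs)" if "length vs = n" for vs
    unfolding distrib_right using that by (blast intro: norm_triangle_mono)
  then show "\<exists>K. \<forall>vs. length vs = n \<longrightarrow> norm (m vs + m' vs) \<le> K * prod_list (map norm vs)"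
    by blast
qed

lemma C_infinity_on_add:
  fixes U :: "'a::real_normed_vector set"
  assumes "C_infinity_on U f" and "C_infinity_on U g"
  shows "C_infinity_on U (\<lambda>x. f x + g x)"
proof -
  obtain D where U: "open U" and D: "\<forall>x\<in>U. D x [] = f x"
      "\<forall>n. \<forall>x\<in>U. bounded_multilinear n (D x)"
      "\<forall>n. \<forall>x\<in>U. \<forall>e>0. \<exists>d>0. \<forall>y\<in>U. norm (y - x) < d \<longrightarrow> (\<forall>vs. length vs = n \<longrightarrow>
        norm (D y vs - D x vs - D x ((y - x) # vs)) \<le> e * norm (y - x) * prod_list (map norm vs))"
    by (rule C_infinity_onE[OF assms(1)], rule that)
  obtain D' where "open U" and D': "\<forall>x\<in>U. D' x [] = g x"
      "\<forall>n. \<forall>x\<in>U. bounded_multilinear n (D' x)"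
      "\<forall>n. \<forall>x\<in>U. \<forall>e>0. \<exists>d>0. \<forall>y\<in>U. norm (y - x) < d \<longrightarrow> (\<forall>vs. length vs = n \<longrightarrow>
        norm (D' y vs - D' x vs - D' x ((y - x) # vs)) \<le> e * norm (y - x) * prod_list (map norm
          vs))"
    by (rule C_infinity_onE[OF assms(2)], rule that)
  show ?thesis
    unfolding C_infinity_on_def
  proof (intro conjI exI[of _ "\<lambda>x vs. D x vs + D' x vs"] ballI allI impI)
    fix n x and e :: real assume x: "x \<in> U" and e: "e > 0"
    obtain d where d: "d > 0" "\<And>y vs. y \<in> U \<Longrightarrow> norm (y - x) < d \<Longrightarrow> length vs = n \<Longrightarrow>
        norm (D y vs - D x vs - D x ((y - x) # vs)) \<le> e/2 * norm (y - x) * prod_list (map norm vs)"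
      using D(3)[rule_format, OF x, of "e/2" n] e by auto
    obtain d' where d': "d' > 0" "\<And>y vs. y \<in> U \<Longrightarrow> norm (y - x) < d' \<Longrightarrow> length vs = n \<Longrightarrow>
        norm (D' y vs - D' x vs - D' x ((y - x) # vs)) \<le> e/2 * norm (y - x) * prod_list (map norm
          vs)"
      using D'(3)[rule_format, OF x, of "e/2" n] e by auto
    show "\<exists>d>0. \<forall>y\<in>U. norm (y - x) < d \<longrightarrow> (\<forall>vs. length vs = n \<longrightarrow>
        norm (D y vs + D' y vs - (D x vs + D' x vs) - (D x ((y - x) # vs) + D' x ((y - x) # vs)))
          \<le> e * norm (y - x) * prod_list (map norm vs))"
    proof (intro exI[of _ "min d d'"] conjI ballI allI impI)
      fix y and vs :: "'a list" assume "y \<in> U" "norm (y - x) < min d d'" "length vs = n"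
      then have "norm ((D y vs - D x vs - D x ((y - x) # vs)) + (D' y vs - D' x vs - D' x ((y - x)
        # vs)))
          \<le> e/2 * norm (y - x) * prod_list (map norm vs) + e/2 * norm (y - x) * prod_list (map
            norm vs)"
        using d d' by (intro norm_triangle_mono) auto
      then show "norm (D y vs + D' y vs - (D x vs + D' x vs) - (D x ((y - x) # vs) + D' x ((y - x)
        # vs)))
          \<le> e * norm (y - x) * prod_list (map norm vs)" by (simp add: algebra_simps)
    qed (use d d' in auto)
  qed (use D(1,2) D'(1,2) U in \<open>auto intro!: bounded_multilinear_add\<close>)
qed

lemma C_infinity_on_compose_left:
  fixes U :: "'a::real_normed_vector set"
  assumes "C_infinity_on U f" and "bounded_linear L"
  shows "C_infinity_on U (\<lambda>x. L (f x))"
proof -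
  interpret L: bounded_linear L by fact
  obtain D where U: "open U" and D: "\<forall>x\<in>U. D x [] = f x"
      "\<forall>n. \<forall>x\<in>U. bounded_multilinear n (D x)"
      "\<forall>n. \<forall>x\<in>U. \<forall>e>0. \<exists>d>0. \<forall>y\<in>U. norm (y - x) < d \<longrightarrow> (\<forall>vs. length vs = n \<longrightarrow>
        norm (D y vs - D x vs - D x ((y - x) # vs)) \<le> e * norm (y - x) * prod_list (map norm vs))"
    by (rule C_infinity_onE[OF assms(1)], rule that)
  obtain C where C: "C > 0" "\<And>z. norm (L z) \<le> norm z * C" using L.pos_bounded by blast
  show ?thesis
    unfolding C_infinity_on_def
  proof (intro conjI exI[of _ "\<lambda>x vs. L (D x vs)"] ballI allI impI)
    fix n x assume x: "x \<in> U"
    obtain K where K: "\<And>vs. length vs = n \<Longrightarrow> norm (D x vs) \<le> K * prod_list (map norm vs)"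
      using D(2) x unfolding bounded_multilinear_def by blast
    have "norm (L (D x vs)) \<le> (K * C) * prod_list (map norm vs)" if "length vs = n" for vs
      using order_trans[OF C(2) mult_right_mono[OF K[OF that], of C]] C(1) by (simp add: mult_ac)
    moreover have "linear (\<lambda>v. L (D x (us @ v # ws)))" if "Suc (length us + length ws) = n" for us
      ws
      using linear_compose[of "\<lambda>v. D x (us @ v # ws)" L] D(2) x that L.linear_axioms
      unfolding bounded_multilinear_def by (auto simp: o_def)
    ultimately show "bounded_multilinear n (\<lambda>vs. L (D x vs))"
      unfolding bounded_multilinear_def by blast
  next
    fix n x and e :: real assume x: "x \<in> U" and e: "e > 0"
    then have "e / C > 0" using C by simp
    then obtain d where d: "d > 0" "\<And>y vs. y \<in> U \<Longrightarrow> norm (y - x) < d \<Longrightarrow> length vs = n \<Longrightarrow>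
        norm (D y vs - D x vs - D x ((y - x) # vs)) \<le> e / C * norm (y - x) * prod_list (map norm
          vs)"
      using D(3)[rule_format, OF x, of "e / C" n] by auto
    show "\<exists>d>0. \<forall>y\<in>U. norm (y - x) < d \<longrightarrow> (\<forall>vs. length vs = n \<longrightarrow>
        norm (L (D y vs) - L (D x vs) - L (D x ((y - x) # vs)))
          \<le> e * norm (y - x) * prod_list (map norm vs))"
    proof (intro exI[of _ d] conjI ballI allI impI)
      fix y and vs :: "'a list" assume "y \<in> U" "norm (y - x) < d" "length vs = n"
      then have "norm (D y vs - D x vs - D x ((y - x) # vs)) * C
          \<le> e / C * norm (y - x) * prod_list (map norm vs) * C"
        using d C by (intro mult_right_mono) auto
      also have "\<dots> = e * norm (y - x) * prod_list (map norm vs)" using C by simp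
      finally show "norm (L (D y vs) - L (D x vs) - L (D x ((y - x) # vs)))
          \<le> e * norm (y - x) * prod_list (map norm vs)"
        using C(2) order_trans by (simp flip: L.diff) blast
    qed (use d in auto)
  qed (use D U in auto)
qed

lemma C_infinity_on_bounded_linear:
  assumes "open U" and "bounded_linear L"
  shows "C_infinity_on U L"
proof -
  interpret L: bounded_linear L by fact
  define D where "D x vs = (case vs of [] \<Rightarrow> L x | [v] \<Rightarrow> L v | _ \<Rightarrow> 0)" for x vs
  have D: "D x [] = L x" "D x [v] = L v" "D x (u # v # ws) = 0" for x u v ws
    by (simp_all add: D_def)
  have D0: "D x (u # ws) = 0" if "ws \<noteq> []" for x u ws using that D by (cases ws) auto
  obtain C where C: "C > 0" "\<And>z. norm (L z) \<le> norm z * C" using L.pos_bounded by blast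
  show ?thesis
    unfolding C_infinity_on_def
  proof (intro conjI exI[of _ D] ballI allI impI)
    fix n x
    have "linear (\<lambda>v. D x (us @ v # ws))" for us ws
    proof (cases "us = [] \<and> ws = []")
      case True
      then show ?thesis using L.linear_axioms by (simp add: D)
    next
      case False
      then have "D x (us @ v # ws) = 0" for v by (cases us) (auto simp: D0)
      then show ?thesis by (simp add: linear_zero)
    qed
    \<comment> \<open>One constant serves all lengths: \<open>norm (L x)\<close> covers the empty
      list and \<open>C\<close> the singletons; longer lists give 0.\<close>
    moreover have "norm (D x vs) \<le> (C + norm (L x)) * prod_list (map norm vs)" for vs
    proof (cases vs)
      case (Cons v ws)
      then show ?thesis using C C(2)[of v]
        by (cases ws) (auto simp: D distrib_right mult.commute[of C] add_increasing2
          prod_list_norm_nonneg)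
    qed (use C in \<open>simp add: D\<close>)
    ultimately show "bounded_multilinear n (D x)" unfolding bounded_multilinear_def by blast
  next
    fix n x and e :: real assume "e > 0"
    then have "norm (D y vs - D x vs - D x ((y - x) # vs)) \<le> e * norm (y - x) * prod_list (map
      norm vs)"
      for y vs
    proof (cases vs)
      case (Cons v ws)
      then show ?thesis using \<open>e > 0\<close> by (cases ws) (auto simp: D prod_list_norm_nonneg)
    qed (simp add: D L.diff)
    then show "\<exists>d>0. \<forall>y\<in>U. norm (y - x) < d \<longrightarrow> (\<forall>vs. length vs = n \<longrightarrow>
        norm (D y vs - D x vs - D x ((y - x) # vs)) \<le> e * norm (y - x) * prod_list (map norm vs))"
      using zero_less_one by blast
  qed (use assms D in auto)
qed

section \<open>Families satisfying the resolvent identity\<close>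

lemma norm_blinfun_compose3: "norm (a o\<^sub>L b o\<^sub>L c) \<le> norm a * norm b * norm c"
  by (meson mult_right_mono norm_blinfun_compose norm_ge_zero order_trans)

lemma quadratic_remainder_has_derivative:
  fixes F :: "'a::real_normed_vector \<Rightarrow> 'b::real_normed_vector"
  assumes "bounded_linear F'"
    and "\<exists>K. \<forall>\<^sub>F y in nhds x. norm (F y - F x - F' (y - x)) \<le> K * (norm (y - x))\<^sup>2"
  shows "(F has_derivative F') (at x)"
proof -
  obtain K where K: "\<forall>\<^sub>F y in nhds x. norm (F y - F x - F' (y - x)) \<le> K * (norm (y - x))\<^sup>2"
    using assms(2) by blast
  have "((\<lambda>y. norm (F y - F x - F' (y - x)) / norm (y - x)) \<longlongrightarrow> 0) (at x)"
  proof (rule Lim_null_comparison)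
    show "\<forall>\<^sub>F y in at x. norm (norm (F y - F x - F' (y - x)) / norm (y - x)) \<le> K * norm (y - x)"
      using K unfolding eventually_at_filter
      by (auto elim!: eventually_mono simp: divide_le_eq power2_eq_square mult.assoc)
    have "((\<lambda>y. K * norm (y - x)) \<longlongrightarrow> K * norm (x - x)) (at x)" by (intro tendsto_intros)
    then show "((\<lambda>y. K * norm (y - x)) \<longlongrightarrow> 0) (at x)" by simp
  qed
  then show ?thesis using assms(1) by (simp add: has_derivative_iff_norm)
qed

text \<open>This is the product rule with a remainder that is uniform over all words of a fixed
  length. The total remainder splits into the remainder of \<open>F\<close> against
  \<open>\<Phi> y\<close>, the derivative of \<open>F\<close> against the increment of
  \<open>\<Phi>\<close>, and \<open>F x\<close> against the remainder of \<open>\<Phi>\<close>; each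
  is quadratic in \<open>y - x\<close>.\<close>

lemma compose_word_quadratic_remainder:
  fixes F :: "'p::real_normed_vector \<Rightarrow> 'c::real_normed_vector \<Rightarrow>\<^sub>L 'd::real_normed_vector"
    and \<Phi> :: "'p \<Rightarrow> ('b::real_normed_vector \<Rightarrow>\<^sub>L 'c) list \<Rightarrow> 'e::real_normed_vector \<Rightarrow>\<^sub>L 'b"
  assumes F: "\<exists>K. \<forall>\<^sub>F y in nhds x. norm (F y - F x - F' (y - x)) \<le> K * (norm (y - x))\<^sup>2"
    and F': "\<exists>C. \<forall>h. norm (F' h) \<le> C * norm h"
    and \<Phi>: "\<exists>K. \<forall>\<^sub>F y in nhds x. \<forall>ws. length ws = n \<longrightarrow>
      norm (\<Phi> y ws - \<Phi> x ws - \<Phi>' (y - x) ws) \<le> K * (norm (y - x))\<^sup>2 * prod_list (map norm ws)"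
    and bound: "\<exists>B. \<forall>ws. length ws = n \<longrightarrow> norm (\<Phi> x ws) \<le> B * prod_list (map norm ws)"
    and \<Phi>': "\<exists>C. \<forall>h ws. length ws = n \<longrightarrow>
      norm (\<Phi>' h ws) \<le> C * norm h * prod_list (map norm ws)"
  shows "\<exists>K. \<forall>\<^sub>F y in nhds x. \<forall>w ws. length ws = n \<longrightarrow>
    norm ((F y o\<^sub>L w o\<^sub>L \<Phi> y ws) - (F x o\<^sub>L w o\<^sub>L \<Phi> x ws) -
        ((F' (y - x) o\<^sub>L w o\<^sub>L \<Phi> x ws) + (F x o\<^sub>L w o\<^sub>L \<Phi>' (y - x) ws)))
      \<le> K * (norm (y - x))\<^sup>2 * (norm w * prod_list (map norm ws))"
proof -
  obtain K1' where K1': "\<forall>\<^sub>F y in nhds x. norm (F y - F x - F' (y - x)) \<le> K1' * (norm (y - x))\<^sup>2"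
    using F by blast
  obtain C' where C': "\<And>h. norm (F' h) \<le> C' * norm h" using F' by blast
  obtain K2' where K2': "\<forall>\<^sub>F y in nhds x. \<forall>ws. length ws = n \<longrightarrow>
      norm (\<Phi> y ws - \<Phi> x ws - \<Phi>' (y - x) ws) \<le> K2' * (norm (y - x))\<^sup>2 * prod_list (map norm ws)"
    using \<Phi> by blast
  obtain B' where B': "\<And>ws. length ws = n \<Longrightarrow> norm (\<Phi> x ws) \<le> B' * prod_list (map norm ws)"
    using bound by blast
  obtain D' where D': "\<And>h ws. length ws = n \<Longrightarrow>
      norm (\<Phi>' h ws) \<le> D' * norm h * prod_list (map norm ws)" using \<Phi>' by blast
  \<comment> \<open>Absolute values make the constants nonnegative, as multiplying the estimates
    requires.\<close>
  define K1 C K2 B D where "K1 = \<bar>K1'\<bar>" "C = \<bar>C'\<bar>" "K2 = \<bar>K2'\<bar>" "B = \<bar>B'\<bar>" "D = \<bar>D'\<bar>"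
  note defs = this
  have nn: "K1 \<ge> 0" "C \<ge> 0" "K2 \<ge> 0" "B \<ge> 0" "D \<ge> 0" by (simp_all add: defs)
  define K where "K = K1 * (B + D + K2) + C * (D + K2) + norm (F x) * K2"
  have C: "norm (F' h) \<le> C * norm h" for h
    using C'[of h] by (rule order_trans) (auto simp: defs intro: mult_right_mono)
  have B: "norm (\<Phi> x ws) \<le> B * prod_list (map norm ws)" if "length ws = n" for ws
    using B'[OF that] by (rule order_trans) (auto simp: defs intro!: mult_right_mono
      prod_list_norm_nonneg)
  have D: "norm (\<Phi>' h ws) \<le> D * norm h * prod_list (map norm ws)" if "length ws = n" for h ws
    using D'[OF that, of h]
    by (rule order_trans) (auto simp: defs intro!: mult_right_mono prod_list_norm_nonneg)
  have "\<forall>\<^sub>F y in nhds x. norm (y - x) < 1"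
    using eventually_nhds_metric[of "\<lambda>y. norm (y - x) < 1" x] zero_less_one
    by (auto simp: dist_norm intro!: exI[of _ 1])
  with K1' K2' have "\<forall>\<^sub>F y in nhds x. \<forall>w ws. length ws = n \<longrightarrow>
    norm ((F y o\<^sub>L w o\<^sub>L \<Phi> y ws) - (F x o\<^sub>L w o\<^sub>L \<Phi> x ws) -
        ((F' (y - x) o\<^sub>L w o\<^sub>L \<Phi> x ws) + (F x o\<^sub>L w o\<^sub>L \<Phi>' (y - x) ws)))
      \<le> K * (norm (y - x))\<^sup>2 * (norm w * prod_list (map norm ws))"
  proof eventually_elim
    case (elim y)
    define h where "h = y - x"
    show ?case
    proof (intro allI impI, fold h_def)
      fix w and ws :: "('b \<Rightarrow>\<^sub>L 'c) list" assume n: "length ws = n"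
      define \<pi> where "\<pi> = prod_list (map norm ws)"
      have \<pi>: "\<pi> \<ge> 0" by (simp add: \<pi>_def prod_list_norm_nonneg)
      have h: "norm h < 1" using elim by (simp add: h_def)
      \<comment> \<open>Since \<open>norm h < 1\<close>, quadratic errors are absorbed into linear
        ones, and these into constants.\<close>
      have h2: "(norm h)\<^sup>2 \<le> norm h" using h by (simp add: power2_eq_square mult_left_le)
      have r1: "norm (F y - F x - F' h) \<le> K1 * (norm h)\<^sup>2"
        using elim(1) unfolding h_def by (rule order_trans) (auto simp: defs intro: mult_right_mono)
      have r2: "norm (\<Phi> y ws - \<Phi> x ws - \<Phi>' h ws) \<le> K2 * (norm h)\<^sup>2 * \<pi>"
        using elim(2)[rule_format, OF n] unfolding h_def
        by (rule order_trans) (auto simp: defs \<pi>_def intro!: mult_right_mono prod_list_norm_nonneg)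
      have B: "norm (\<Phi> x ws) \<le> B * \<pi>" and D: "norm (\<Phi>' h ws) \<le> D * norm h * \<pi>"
        using B[OF n] D[OF n] by (simp_all add: \<pi>_def)
      have "K2 * (norm h)\<^sup>2 * \<pi> \<le> K2 * norm h * \<pi>"
        using h2 nn \<pi> by (intro mult_right_mono mult_left_mono)
      then have d: "norm (\<Phi> y ws - \<Phi> x ws) \<le> (D + K2) * norm h * \<pi>"
        using norm_triangle_ineq[of "\<Phi> y ws - \<Phi> x ws - \<Phi>' h ws" "\<Phi>' h ws"] r2 D
        by (simp add: distrib_right)
      also have "\<dots> \<le> (D + K2) * \<pi>"
        using h nn \<pi> by (intro mult_right_mono) (auto simp: mult_left_le)
      finally have b: "norm (\<Phi> y ws) \<le> (B + D + K2) * \<pi>"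
        using norm_triangle_ineq[of "\<Phi> y ws - \<Phi> x ws" "\<Phi> x ws"] B by (simp add: distrib_right)
      have t1: "norm ((F y - F x - F' h) o\<^sub>L w o\<^sub>L \<Phi> y ws)
          \<le> K1 * (norm h)\<^sup>2 * norm w * ((B + D + K2) * \<pi>)"
        by (rule order_trans[OF norm_blinfun_compose3])
          (use r1 b nn in \<open>auto intro!: mult_mono\<close>)
      have t2: "norm (F' h o\<^sub>L w o\<^sub>L (\<Phi> y ws - \<Phi> x ws))
          \<le> C * norm h * norm w * ((D + K2) * norm h * \<pi>)"
        by (rule order_trans[OF norm_blinfun_compose3])
          (use C d nn in \<open>auto intro!: mult_mono\<close>)
      have t3: "norm (F x o\<^sub>L w o\<^sub>L (\<Phi> y ws - \<Phi> x ws - \<Phi>' h ws))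
          \<le> norm (F x) * norm w * (K2 * (norm h)\<^sup>2 * \<pi>)"
        by (rule order_trans[OF norm_blinfun_compose3]) (use r2 in \<open>auto intro!: mult_mono\<close>)
      have "(F y o\<^sub>L w o\<^sub>L \<Phi> y ws) - (F x o\<^sub>L w o\<^sub>L \<Phi> x ws) -
          ((F' h o\<^sub>L w o\<^sub>L \<Phi> x ws) + (F x o\<^sub>L w o\<^sub>L \<Phi>' h ws)) =
          ((F y - F x - F' h) o\<^sub>L w o\<^sub>L \<Phi> y ws) + (F' h o\<^sub>L w o\<^sub>L (\<Phi> y ws - \<Phi> x ws)) +
          (F x o\<^sub>L w o\<^sub>L (\<Phi> y ws - \<Phi> x ws - \<Phi>' h ws))"
        by (rule blinfun_eqI) (simp add: blinfun.bilinear_simps)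
      then have "norm ((F y o\<^sub>L w o\<^sub>L \<Phi> y ws) - (F x o\<^sub>L w o\<^sub>L \<Phi> x ws) -
          ((F' h o\<^sub>L w o\<^sub>L \<Phi> x ws) + (F x o\<^sub>L w o\<^sub>L \<Phi>' h ws))) \<le>
          K1 * (norm h)\<^sup>2 * norm w * ((B + D + K2) * \<pi>) +
          C * norm h * norm w * ((D + K2) * norm h * \<pi>) +
          norm (F x) * norm w * (K2 * (norm h)\<^sup>2 * \<pi>)"
        using norm_triangle_mono[OF norm_triangle_mono[OF t1 t2] t3] by simp
      also have "\<dots> = K * (norm h)\<^sup>2 * (norm w * \<pi>)"
        by (simp add: K_def power2_eq_square algebra_simps)
      finally show "norm ((F y o\<^sub>L w o\<^sub>L \<Phi> y ws) - (F x o\<^sub>L w o\<^sub>L \<Phi> x ws) -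
          ((F' h o\<^sub>L w o\<^sub>L \<Phi> x ws) + (F x o\<^sub>L w o\<^sub>L \<Phi>' h ws)))
          \<le> K * (norm h)\<^sup>2 * (norm w * prod_list (map norm ws))" by (simp add: \<pi>_def)
    qed
  qed
  then show ?thesis by blast
qed


section \<open>Calculus from the resolvent identity\<close>

text \<open>Inversion is the model case. Substituting the identity into itself yields all
  derivatives together with exact remainders.\<close>

locale resolvent_family =
  fixes U :: "('a::real_normed_vector \<Rightarrow>\<^sub>L 'b::real_normed_vector) set" and G :: "('a \<Rightarrow>\<^sub>L 'b) \<Rightarrow> ('b
    \<Rightarrow>\<^sub>L 'a)"
  assumes open_U: "open U"
    and resolvent: "X \<in> U \<Longrightarrow> Y \<in> U \<Longrightarrow> G Y - G X = (G Y o\<^sub>L (X - Y) o\<^sub>L G X)"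
begin

text \<open>The letters r and l tell at which end of an operator word the factor stands.
  \<open>defect X\<close> is \<open>X\<close> followed by \<open>ldefect X\<close>, and also
  \<open>rdefect X\<close> followed by \<open>X\<close>; it vanishes exactly when \<open>G X\<close>
  is an inner inverse of \<open>X\<close>.\<close>

definition rdefect where "rdefect X = id_blinfun - (G X o\<^sub>L X)"
definition ldefect where "ldefect X = id_blinfun - (X o\<^sub>L G X)"
definition defect where "defect X = X - (X o\<^sub>L G X o\<^sub>L X)"

lemma rdefect_apply: "rdefect X z = z - G X (X z)"
  by (simp add: rdefect_def blinfun.bilinear_simps)

lemma ldefect_apply: "ldefect X z = z - X (G X z)"
  by (simp add: ldefect_def blinfun.bilinear_simps)

lemma defect_apply: "defect X z = X z - X (G X (X z))"
  by (simp add: defect_def blinfun.bilinear_simps)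

lemma resolvent_left:
  assumes "X \<in> U" "X + H \<in> U"
  shows "G (X + H) (H (G X z)) = G X z - G (X + H) z"
proof -
  have "(G (X + H) - G X) z = (G (X + H) o\<^sub>L (X - (X + H)) o\<^sub>L G X) z"
    using resolvent[OF assms] by simp
  then show ?thesis by (simp add: blinfun.bilinear_simps algebra_simps)
qed

lemma resolvent_right:
  assumes "X \<in> U" "X + H \<in> U"
  shows "G X (H (G (X + H) z)) = G X z - G (X + H) z"
proof -
  have "(G X - G (X + H)) z = (G X o\<^sub>L (X + H - X) o\<^sub>L G (X + H)) z"
    using resolvent[OF assms(2,1)] by simp
  then show ?thesis by (simp add: blinfun.diff_left)
qed

lemma rdefect_difference:
  assumes "X \<in> U" "X + H \<in> U"
  shows "G (X + H) (H (rdefect X z)) = rdefect X z - rdefect (X + H) z"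
  using resolvent_left[OF assms, of "X z"] by (simp add: rdefect_apply blinfun.bilinear_simps
    algebra_simps)

lemma ldefect_difference:
  assumes "X \<in> U" "X + H \<in> U"
  shows "ldefect X (H (G (X + H) z)) = ldefect X z - ldefect (X + H) z"
  by (simp add: ldefect_apply resolvent_right[OF assms] blinfun.diff_right blinfun.add_left)

lemma defect_difference:
  assumes "X \<in> U" "X + H \<in> U"
  shows "ldefect X (H (rdefect (X + H) z)) = defect (X + H) z - defect X z"
  using ldefect_difference[OF assms, of "(X + H) z"]
  by (simp add: ldefect_apply rdefect_apply defect_apply blinfun.bilinear_simps algebra_simps)

text \<open>In \<open>G (X + H) - G X = - G (X + H) H G X\<close> the factor
  \<open>G (X + H)\<close> is expanded once more by the same formula. What is left contains
  \<open>H\<close> twice and is exact. The three lemmas that follow use the same expansion.\<close>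

lemma G_remainder:
  assumes "X \<in> U" "X + H \<in> U"
  shows "G (X + H) - G X - (- (G X o\<^sub>L H o\<^sub>L G X)) = (G (X + H) o\<^sub>L H o\<^sub>L (G X o\<^sub>L H o\<^sub>L G X))"
  by (rule blinfun_eqI)
    (simp only: blinfun.add_left blinfun.diff_left blinfun.minus_left
      blinfun.diff_right blinfun_apply_blinfun_compose
      resolvent_left[OF assms], simp)

lemma rdefect_remainder:
  assumes "X \<in> U" "X + H \<in> U"
  shows "rdefect (X + H) - rdefect X - (- (G X o\<^sub>L H o\<^sub>L rdefect X)) = (G (X + H) o\<^sub>L H o\<^sub>L (G X
    o\<^sub>L H o\<^sub>L rdefect X))"
  by (rule blinfun_eqI)
    (simp only: blinfun.add_left blinfun.diff_left blinfun.minus_left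
      blinfun.diff_right blinfun_apply_blinfun_compose
      resolvent_left[OF assms] rdefect_difference[OF assms], simp)

lemma ldefect_remainder:
  assumes "X \<in> U" "X + H \<in> U"
  shows "ldefect (X + H) - ldefect X - (- (ldefect X o\<^sub>L H o\<^sub>L G X)) = (ldefect X o\<^sub>L H o\<^sub>L (G (X
    + H) o\<^sub>L H o\<^sub>L G X))"
  by (rule blinfun_eqI)
    (simp only: blinfun.add_left blinfun.diff_left blinfun.minus_left
      blinfun.diff_right blinfun_apply_blinfun_compose
      resolvent_left[OF assms], simp add: ldefect_difference[OF assms])

lemma defect_remainder:
  assumes "X \<in> U" "X + H \<in> U"
  shows "defect (X + H) - defect X - (ldefect X o\<^sub>L H o\<^sub>L rdefect X) = - (ldefect X o\<^sub>L H o\<^sub>L (G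
    (X + H) o\<^sub>L H o\<^sub>L rdefect X))"
  by (rule blinfun_eqI)
    (simp only: blinfun.add_left blinfun.diff_left blinfun.minus_left
      blinfun.diff_right blinfun_apply_blinfun_compose
      rdefect_difference[OF assms] defect_difference[OF assms], simp)

text \<open>If \<open>norm (Y - X) * norm (G X) < 1/2\<close>, the identity gives
  \<open>norm (G Y) \<le> norm (G X) + norm (G Y) / 2\<close>. The exact remainders contain
  \<open>G\<close> at the displaced point, and this local bound makes them quadratic in the
  displacement.\<close>

lemma eventually_G_bound:
  assumes "X \<in> U"
  shows "\<forall>\<^sub>F Y in nhds X. Y \<in> U \<and> norm (G Y) \<le> 2 * norm (G X)"
proof -
  have "((\<lambda>Y. norm (Y - X) * norm (G X)) \<longlongrightarrow> norm (X - X) * norm (G X)) (nhds X)"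
    by (intro tendsto_intros filterlim_ident)
  then have "\<forall>\<^sub>F Y in nhds X. norm (Y - X) * norm (G X) < 1/2"
    by (rule order_tendstoD) simp
  moreover have "\<forall>\<^sub>F Y in nhds X. Y \<in> U" using open_U assms by (rule eventually_nhds_in_open)
  ultimately show ?thesis
  proof eventually_elim
    case (elim Y)
    have "G Y = G X + (G Y o\<^sub>L (X - Y) o\<^sub>L G X)"
      using resolvent[OF assms elim(2)] by (simp add: algebra_simps)
    then have "norm (G Y) \<le> norm (G X) + norm (G Y o\<^sub>L (X - Y) o\<^sub>L G X)"
      by (metis norm_triangle_ineq)
    also have "\<dots> \<le> norm (G X) + norm (G Y) * norm (X - Y) * norm (G X)"
      by (intro add_left_mono norm_blinfun_compose3)
    also have "\<dots> \<le> norm (G X) + norm (G Y) * (1/2)"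
      using mult_left_mono[OF less_imp_le[OF elim(1)], of "norm (G Y)"]
      by (simp add: norm_minus_commute mult.assoc)
    finally show ?case using elim(2) by simp
  qed
qed

lemma quadratic_remainderI:
  assumes "X \<in> U"
    and "\<And>H. X + H \<in> U \<Longrightarrow> norm (F (X + H) - F X - F' H) \<le> norm (G (X + H)) * c * (norm H)\<^sup>2"
    and "c \<ge> 0"
  shows "\<exists>K. \<forall>\<^sub>F Y in nhds X. norm (F Y - F X - F' (Y - X)) \<le> K * (norm (Y - X))\<^sup>2"
proof -
  have "\<forall>\<^sub>F Y in nhds X. norm (F Y - F X - F' (Y - X)) \<le> (2 * norm (G X) * c) * (norm (Y - X))\<^sup>2"
    using eventually_G_bound[OF assms(1)]
  proof eventually_elim
    case (elim Y)
    then have "norm (F Y - F X - F' (Y - X)) \<le> norm (G Y) * c * (norm (Y - X))\<^sup>2"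
      using assms(2)[of "Y - X"] by simp
    also have "\<dots> \<le> (2 * norm (G X) * c) * (norm (Y - X))\<^sup>2"
      using elim assms(3) by (intro mult_right_mono) auto
    finally show ?case .
  qed
  then show ?thesis by blast
qed

lemma norm_blinfun_compose5:
  "norm (a o\<^sub>L H o\<^sub>L (b o\<^sub>L H o\<^sub>L c)) \<le> norm a * norm b * norm c * (norm H)\<^sup>2"
proof -
  have "norm (a o\<^sub>L H o\<^sub>L (b o\<^sub>L H o\<^sub>L c)) \<le> norm a * norm H * (norm b * norm H * norm c)"
    by (rule order_trans[OF norm_blinfun_compose3]) (intro mult_left_mono norm_blinfun_compose3,
      simp)
  then show ?thesis by (simp add: power2_eq_square mult_ac)
qed

lemma G_quadratic:
  assumes "X \<in> U"
  shows "\<exists>K. \<forall>\<^sub>F Y in nhds X. norm (G Y - G X - - (G X o\<^sub>L (Y - X) o\<^sub>L G X)) \<le> K * (norm (Y - X))\<^sup>2"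
  using assms
proof (rule quadratic_remainderI[where c = "norm (G X) * norm (G X)"])
  show "norm (G (X + H) - G X - - (G X o\<^sub>L H o\<^sub>L G X))
      \<le> norm (G (X + H)) * (norm (G X) * norm (G X)) * (norm H)\<^sup>2" if "X + H \<in> U" for H
    using norm_blinfun_compose5[of "G (X + H)" H "G X" "G X"] by (simp only: G_remainder[OF assms
      that] mult.assoc)
qed simp

lemma rdefect_quadratic:
  assumes "X \<in> U"
  shows "\<exists>K. \<forall>\<^sub>F Y in nhds X. norm (rdefect Y - rdefect X - - (G X o\<^sub>L (Y - X) o\<^sub>L rdefect X)) \<le> K
    * (norm (Y - X))\<^sup>2"
  using assms
proof (rule quadratic_remainderI[where c = "norm (G X) * norm (rdefect X)"])
  show "norm (rdefect (X + H) - rdefect X - - (G X o\<^sub>L H o\<^sub>L rdefect X))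
      \<le> norm (G (X + H)) * (norm (G X) * norm (rdefect X)) * (norm H)\<^sup>2" if "X + H \<in> U" for H
    using norm_blinfun_compose5[of "G (X + H)" H "G X" "rdefect X"] by (simp only:
      rdefect_remainder[OF assms that] mult.assoc)
qed simp

lemma ldefect_quadratic:
  assumes "X \<in> U"
  shows "\<exists>K. \<forall>\<^sub>F Y in nhds X. norm (ldefect Y - ldefect X - - (ldefect X o\<^sub>L (Y - X) o\<^sub>L G X)) \<le> K
    * (norm (Y - X))\<^sup>2"
  using assms
proof (rule quadratic_remainderI[where c = "norm (ldefect X) * norm (G X)"])
  show "norm (ldefect (X + H) - ldefect X - - (ldefect X o\<^sub>L H o\<^sub>L G X))
      \<le> norm (G (X + H)) * (norm (ldefect X) * norm (G X)) * (norm H)\<^sup>2" if "X + H \<in> U" for H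
    using norm_blinfun_compose5[of "ldefect X" H "G (X + H)" "G X"]
    by (simp only: ldefect_remainder[OF assms that] mult_ac)
qed simp

lemma defect_quadratic:
  assumes "X \<in> U"
  shows "\<exists>K. \<forall>\<^sub>F Y in nhds X. norm (defect Y - defect X - (ldefect X o\<^sub>L (Y - X) o\<^sub>L rdefect X)) \<le>
    K * (norm (Y - X))\<^sup>2"
  using assms
proof (rule quadratic_remainderI[where c = "norm (ldefect X) * norm (rdefect X)"])
  show "norm (defect (X + H) - defect X - (ldefect X o\<^sub>L H o\<^sub>L rdefect X))
      \<le> norm (G (X + H)) * (norm (ldefect X) * norm (rdefect X)) * (norm H)\<^sup>2" if "X + H \<in> U" for H
    using norm_blinfun_compose5[of "ldefect X" H "G (X + H)" "rdefect X"]
    by (simp only: defect_remainder[OF assms that] norm_minus_cancel mult_ac)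
qed simp

end

section \<open>Higher derivatives of the defect as operator words\<close>

lemma linear_compose_middle: "linear (\<lambda>v. a o\<^sub>L v o\<^sub>L b)"
  by (rule linearI) (auto intro!: blinfun_eqI simp: blinfun.bilinear_simps)

lemma linear_compose_last: "linear (\<lambda>v. a o\<^sub>L w o\<^sub>L v)"
  by (rule linearI) (auto intro!: blinfun_eqI simp: blinfun.bilinear_simps)

lemma blinfun_compose_minus_left: "(- a o\<^sub>L b) = - (a o\<^sub>L b)"
  by (rule blinfun_eqI) (simp add: blinfun.minus_left)

lemma norm_compose_word:
  assumes "norm \<phi> \<le> K * \<pi>"
  shows "norm (a o\<^sub>L w o\<^sub>L \<phi>) \<le> norm a * K * (norm w * \<pi>)"
proof -
  have "norm (a o\<^sub>L w o\<^sub>L \<phi>) \<le> norm a * norm w * norm \<phi>" by (rule norm_blinfun_compose3)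
  also have "\<dots> \<le> norm a * norm w * (K * \<pi>)" using assms by (intro mult_left_mono) auto
  finally show ?thesis by (simp add: mult_ac)
qed

lemma compose_bounded:
  "\<exists>C. \<forall>h. norm (a o\<^sub>L h o\<^sub>L b) \<le> C * norm h"
proof (intro exI[of _ "norm a * norm b"] allI)
  show "norm (a o\<^sub>L h o\<^sub>L b) \<le> norm a * norm b * norm h" for h
    using norm_blinfun_compose3[of a h b] by (simp add: mult_ac)
qed

context resolvent_family
begin

text \<open>In direction \<open>H\<close> the derivatives of \<open>G\<close>, \<open>rdefect\<close>, \<open>ldefect\<close> and \<open>defect\<close> are \<open>- G H G\<close>,
  \<open>- G H rdefect\<close>, \<open>- ldefect H G\<close> and \<open>ldefect H rdefect\<close>, so that differentiating the word
  \<open>ldefect V\<^sub>1 (- G) V\<^sub>2 \<dots> (- G) V\<^sub>n rdefect\<close> inserts \<open>H\<close> at each of the \<open>n + 1\<close> positions.\<close>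

primrec rdefect_word where
  "rdefect_word X [] = rdefect X"
| "rdefect_word X (w # ws) = (- G X o\<^sub>L w o\<^sub>L rdefect_word X ws)"

primrec defect_word where
  "defect_word X [] = defect X"
| "defect_word X (w # ws) = (ldefect X o\<^sub>L w o\<^sub>L rdefect_word X ws)"

lemma rdefect_word_linear: "linear (\<lambda>v. rdefect_word X (us @ v # ws))"
proof (induction us)
  case (Cons u us)
  then show ?case
    using linear_compose[OF Cons linear_compose_last[of "- G X" u]] by (simp add: o_def)
qed (simp add: linear_compose_middle)

lemma defect_word_linear: "linear (\<lambda>v. defect_word X (us @ v # ws))"
proof (cases us)
  case (Cons u us')
  then show ?thesis
    using linear_compose[OF rdefect_word_linear linear_compose_last[of "ldefect X" u]] by (simp
      add: o_def)
qed (simp add: linear_compose_middle)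

lemma rdefect_word_bound: "\<exists>K. \<forall>ws. length ws = n \<longrightarrow> norm (rdefect_word X ws) \<le> K * prod_list (map
  norm ws)"
proof (induction n)
  case 0
  then show ?case by auto
next
  case (Suc n)
  then obtain K where K: "\<And>ws. length ws = n \<Longrightarrow> norm (rdefect_word X ws) \<le> K * prod_list (map norm
    ws)"
    by blast
  have "norm (rdefect_word X ws) \<le> norm (- G X) * K * prod_list (map norm ws)" if "length ws = Suc
    n" for ws
    using that norm_compose_word[OF K, of _ "- G X"] by (cases ws) auto
  then show ?case by blast
qed

lemma defect_word_bound: "\<exists>K. \<forall>ws. length ws = n \<longrightarrow> norm (defect_word X ws) \<le> K * prod_list (map
  norm ws)"
proof (cases n)
  case 0
  then show ?thesis by auto
next
  case (Suc n')
  obtain K where K: "\<And>ws. length ws = n' \<Longrightarrow> norm (rdefect_word X ws) \<le> K * prod_list (map norm ws)"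
    using rdefect_word_bound by blast
  have "norm (defect_word X ws) \<le> norm (ldefect X) * K * prod_list (map norm ws)" if "length ws =
    n" for ws
    using that norm_compose_word[OF K, of _ "ldefect X"] Suc by (cases ws) auto
  then show ?thesis by blast
qed

lemma insert_sum_rdefect_word_bound:
  "\<exists>C. \<forall>h ws. length ws = n \<longrightarrow>
    norm (insert_sum h (rdefect_word X) ws) \<le> C * norm h * prod_list (map norm ws)"
proof -
  obtain K where "\<And>ws. length ws = Suc n \<Longrightarrow> norm (rdefect_word X ws) \<le> K * prod_list (map norm ws)"
    using rdefect_word_bound by blast
  then have "norm (insert_sum h (rdefect_word X) ws) \<le> real (Suc n) * K * norm h * prod_list (map
    norm ws)"
    if "length ws = n" for h ws
    using insert_sum_bound[of ws "rdefect_word X" K h] that by blast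
  then show ?thesis by blast
qed

text \<open>Inserting \<open>h\<close> in front of \<open>w\<close> differentiates the leading
  factor \<open>- G X\<close>, giving \<open>G X h G X\<close>; every other position lies in the
  inner word. This is the Leibniz rule in the shape of
  \<open>compose_word_quadratic_remainder\<close>.\<close>

lemma insert_sum_rdefect_word_Cons:
  "insert_sum h (rdefect_word X) (w # ws) =
    ((G X o\<^sub>L h o\<^sub>L G X) o\<^sub>L w o\<^sub>L rdefect_word X ws) + (- G X o\<^sub>L w o\<^sub>L insert_sum h
      (rdefect_word X) ws)"
proof -
  have "insert_sum h (\<lambda>q. - G X o\<^sub>L w o\<^sub>L rdefect_word X q) ws = (- G X o\<^sub>L w o\<^sub>L insert_sum h
    (rdefect_word X) ws)"
    by (rule insert_sum_linear_image[OF linear_compose_last])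
  moreover have "rdefect_word X (h # w # ws) = ((G X o\<^sub>L h o\<^sub>L G X) o\<^sub>L w o\<^sub>L rdefect_word X ws)"
    by (rule blinfun_eqI) (simp add: blinfun.bilinear_simps)
  ultimately show ?thesis by simp
qed

lemma insert_sum_defect_word_Cons:
  "insert_sum h (defect_word X) (w # ws) =
    (- (ldefect X o\<^sub>L h o\<^sub>L G X) o\<^sub>L w o\<^sub>L rdefect_word X ws) + (ldefect X o\<^sub>L w o\<^sub>L insert_sum h
      (rdefect_word X) ws)"
proof -
  have "insert_sum h (\<lambda>q. ldefect X o\<^sub>L w o\<^sub>L rdefect_word X q) ws = (ldefect X o\<^sub>L w o\<^sub>L
    insert_sum h (rdefect_word X) ws)"
    by (rule insert_sum_linear_image[OF linear_compose_last])
  moreover have "defect_word X (h # w # ws) = (- (ldefect X o\<^sub>L h o\<^sub>L G X) o\<^sub>L w o\<^sub>L rdefect_word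
    X ws)"
    by (rule blinfun_eqI) (simp add: blinfun.bilinear_simps)
  ultimately show ?thesis by simp
qed

text \<open>Induction on the length: the product rule combines the leading \<open>- G X\<close> with
  the shorter word.\<close>

lemma rdefect_word_quadratic:
  assumes X: "X \<in> U"
  shows "\<exists>K. \<forall>\<^sub>F Y in nhds X. \<forall>ws. length ws = n \<longrightarrow>
    norm (rdefect_word Y ws - rdefect_word X ws - insert_sum (Y - X) (rdefect_word X) ws)
      \<le> K * (norm (Y - X))\<^sup>2 * prod_list (map norm ws)"
proof (induction n)
  case 0
  then show ?case using rdefect_quadratic[OF X] by (simp add: blinfun_compose_minus_left)
next
  case (Suc n)
  have "norm (- G Y - - G X - (G X o\<^sub>L H o\<^sub>L G X)) = norm (G Y - G X - - (G X o\<^sub>L H o\<^sub>L G X))" for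
    Y H
    by (subst norm_minus_cancel[symmetric]) simp
  then have "\<exists>K. \<forall>\<^sub>F Y in nhds X. norm (- G Y - - G X - (G X o\<^sub>L (Y - X) o\<^sub>L G X)) \<le> K * (norm (Y
    - X))\<^sup>2"
    using G_quadratic[OF X] by simp
  from compose_word_quadratic_remainder[OF this compose_bounded Suc rdefect_word_bound
    insert_sum_rdefect_word_bound]
  obtain K where "\<forall>\<^sub>F Y in nhds X. \<forall>w ws. length ws = n \<longrightarrow>
    norm ((- G Y o\<^sub>L w o\<^sub>L rdefect_word Y ws) - (- G X o\<^sub>L w o\<^sub>L rdefect_word X ws) -
        insert_sum (Y - X) (rdefect_word X) (w # ws))
      \<le> K * (norm (Y - X))\<^sup>2 * (norm w * prod_list (map norm ws))"
    unfolding insert_sum_rdefect_word_Cons by blast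
  then have "\<forall>\<^sub>F Y in nhds X. \<forall>ws. length ws = Suc n \<longrightarrow>
      norm (rdefect_word Y ws - rdefect_word X ws - insert_sum (Y - X) (rdefect_word X) ws)
        \<le> K * (norm (Y - X))\<^sup>2 * prod_list (map norm ws)"
    by (rule eventually_mono) (auto simp: length_Suc_conv simp del: insert_sum.simps)
  then show ?case by blast
qed

text \<open>After the leading \<open>ldefect X\<close> there stands a word treated before, so a
  single use of the product rule suffices.\<close>

lemma defect_word_quadratic:
  assumes X: "X \<in> U"
  shows "\<exists>K. \<forall>\<^sub>F Y in nhds X. \<forall>ws. length ws = n \<longrightarrow>
    norm (defect_word Y ws - defect_word X ws - insert_sum (Y - X) (defect_word X) ws)
      \<le> K * (norm (Y - X))\<^sup>2 * prod_list (map norm ws)"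
proof (cases n)
  case 0
  then show ?thesis using defect_quadratic[OF X] by simp
next
  case (Suc n')
  have "\<exists>C. \<forall>h. norm (- (ldefect X o\<^sub>L h o\<^sub>L G X)) \<le> C * norm h" using compose_bounded by simp
  from compose_word_quadratic_remainder[OF ldefect_quadratic[OF X] this rdefect_word_quadratic[OF X]
      rdefect_word_bound insert_sum_rdefect_word_bound, of n']
  obtain K where "\<forall>\<^sub>F Y in nhds X. \<forall>w ws. length ws = n' \<longrightarrow>
    norm ((ldefect Y o\<^sub>L w o\<^sub>L rdefect_word Y ws) - (ldefect X o\<^sub>L w o\<^sub>L rdefect_word X ws) -
        insert_sum (Y - X) (defect_word X) (w # ws))
      \<le> K * (norm (Y - X))\<^sup>2 * (norm w * prod_list (map norm ws))"
    unfolding insert_sum_defect_word_Cons by blast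
  then have "\<forall>\<^sub>F Y in nhds X. \<forall>ws. length ws = n \<longrightarrow>
      norm (defect_word Y ws - defect_word X ws - insert_sum (Y - X) (defect_word X) ws)
        \<le> K * (norm (Y - X))\<^sup>2 * prod_list (map norm ws)"
    by (rule eventually_mono) (auto simp: Suc length_Suc_conv simp del: insert_sum.simps)
  then show ?thesis by blast
qed

lemma defect_C_infinity: "C_infinity_on U defect"
  by (rule C_infinity_on_perm_sumI[where m = defect_word])
    (simp_all add: open_U defect_word_linear defect_word_bound defect_word_quadratic)

lemma defect_has_derivative:
  assumes "X \<in> U"
  shows "(defect has_derivative (\<lambda>H. ldefect X o\<^sub>L H o\<^sub>L rdefect X)) (at X)"
  by (rule quadratic_remainder_has_derivative[OF _ defect_quadratic[OF assms]])
    (auto intro!: bounded_linear_intros bounded_linear_minus)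

lemma rdefect_has_derivative:
  assumes "X \<in> U"
  shows "(rdefect has_derivative (\<lambda>H. - (G X o\<^sub>L H o\<^sub>L rdefect X))) (at X)"
  by (rule quadratic_remainder_has_derivative[OF _ rdefect_quadratic[OF assms]])
    (auto intro!: bounded_linear_intros bounded_linear_minus)

lemma ldefect_has_derivative:
  assumes "X \<in> U"
  shows "(ldefect has_derivative (\<lambda>H. - (ldefect X o\<^sub>L H o\<^sub>L G X))) (at X)"
  by (rule quadratic_remainder_has_derivative[OF _ ldefect_quadratic[OF assms]])
    (auto intro!: bounded_linear_intros bounded_linear_minus)

end

section \<open>The submanifold\<close>

text \<open>\<open>A B\<close> and \<open>B A\<close> are bounded projections, onto
  \<open>R(A)\<close> along \<open>N(B)\<close> and onto \<open>R(B)\<close> along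
  \<open>N(A)\<close>. They put every operator into block form, with blocks \<open>a\<close>,
  \<open>b\<close>, \<open>c\<close>, \<open>d\<close>.\<close>

locale generalized_inverse =
  fixes A :: "'a::banach \<Rightarrow>\<^sub>L 'b::banach" and B :: "'b \<Rightarrow>\<^sub>L 'a"
  assumes ABA: "A o\<^sub>L B o\<^sub>L A = A" and BAB: "B o\<^sub>L A o\<^sub>L B = B"
begin

lemma ABA_apply [simp]: "A (B (A x)) = A x"
  using arg_cong[OF ABA, of "\<lambda>T. blinfun_apply T x"] by simp

lemma BAB_apply [simp]: "B (A (B y)) = B y"
  using arg_cong[OF BAB, of "\<lambda>T. blinfun_apply T y"] by simp

text \<open>Only the block \<open>a\<close> of \<open>X\<close> enters. On \<open>R(A)\<close> the
  identity plus the operator in the norm is \<open>a\<close> composed with \<open>B\<close>, so the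
  Neumann series makes \<open>a\<close> invertible.\<close>

definition U where "U = {X. norm (A o\<^sub>L B o\<^sub>L (X - A) o\<^sub>L B) < 1}"

text \<open>The first two equations say that \<open>G\<close> maps into \<open>R(B)\<close> and
  vanishes on \<open>N(B)\<close>; the other two, that it inverts \<open>a\<close> from both
  sides.\<close>

definition local_inverse where
  "local_inverse X G \<longleftrightarrow>
    (\<forall>y. B (A (blinfun_apply G y)) = G y) \<and> (\<forall>y. G (A (B y)) = G y) \<and>
    (\<forall>y. A (B (blinfun_apply X (G y))) = A (B y)) \<and> (\<forall>x. G (X (B (A x))) = B (A x))"

text \<open>\<open>K Y G = G\<close> because \<open>G\<close> maps into \<open>R(B)\<close>, and
  \<open>K X G = K\<close> because \<open>K\<close> vanishes on \<open>N(B)\<close>; the difference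
  is the claim. The case \<open>X = Y\<close> gives uniqueness.\<close>

lemma local_inverse_resolvent:
  assumes "local_inverse X G" and "local_inverse Y K"
  shows "K - G = (K o\<^sub>L (X - Y) o\<^sub>L G)"
proof (rule blinfun_eqI)
  fix y
  have "B (A (G y)) = G y" "A (B (X (G y))) = A (B y)"
    using assms(1) unfolding local_inverse_def by auto
  moreover have "K (A (B y)) = K y" "K (Y (B (A x))) = B (A x)" for x y
    using assms(2) unfolding local_inverse_def by auto
  ultimately have "K (Y (G y)) = G y" "K (X (G y)) = K y" by metis+
  then show "(K - G) y = (K o\<^sub>L (X - Y) o\<^sub>L G) y" by (simp add: blinfun.bilinear_simps)
qed

lemma local_inverse_unique:
  assumes "local_inverse X G" and "local_inverse X K"
  shows "G = K"
  using local_inverse_resolvent[OF assms] by simp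

lemma local_inverse_cong:
  fixes X Y :: "'a \<Rightarrow>\<^sub>L 'b"
  assumes "local_inverse X G" and "\<And>x. A (B (Y (B (A x)))) = A (B (X (B (A x))))"
  shows "local_inverse Y G"
proof -
  have BAG: "B (A (G y)) = G y" and GAB: "G (A (B y)) = G y"
    and ABXG: "A (B (X (G y))) = A (B y)" and GXBA: "G (X (B (A x))) = B (A x)" for x y
    using assms(1) unfolding local_inverse_def by auto
  have "A (B (Y (G y))) = A (B y)" for y using assms(2)[of "G y"] by (simp add: BAG ABXG)
  moreover have "G (Y (B (A x))) = B (A x)" for x
    using arg_cong[OF assms(2)[of x], of G] by (simp add: GAB GXBA)
  ultimately show ?thesis using BAG GAB unfolding local_inverse_def by blast
qed

text \<open>The witness is \<open>B J\<close>, where \<open>J\<close> is the inverse of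
  \<open>id_blinfun + N\<close>.\<close>

lemma local_inverse_exists:
  assumes "X \<in> U"
  shows "\<exists>G. local_inverse X G"
proof -
  define N where "N = (A o\<^sub>L B o\<^sub>L (X - A) o\<^sub>L B)"
  have N: "N y = A (B (X (B y))) - A (B y)" for y
    by (simp add: N_def blinfun.bilinear_simps)
  obtain J where J: "J o\<^sub>L (id_blinfun + N) = id_blinfun" "(id_blinfun + N) o\<^sub>L J = id_blinfun"
    using neumann_inverse[of N] assms unfolding U_def N_def by blast
  have J1: "J (y + N y) = y" for y
    using arg_cong[OF J(1), of "\<lambda>T. blinfun_apply T y"] by (simp add: blinfun.add_left)
  have J2: "J y + N (J y) = y" for y
    using arg_cong[OF J(2), of "\<lambda>T. blinfun_apply T y"] by (simp add: blinfun.add_left)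
  have NAB: "N (A (B y)) = N y" and ABN: "A (B (N y)) = N y" for y
    by (simp_all add: N blinfun.bilinear_simps)
  \<comment> \<open>Composing \<open>N\<close> with \<open>A B\<close> on either side gives
    \<open>N\<close> again, so \<open>N\<close> commutes with this projection, and its resolvent
    \<open>J\<close> inherits this.\<close>
  have comm: "A (B (J y)) = J (A (B y))" for y
  proof -
    have "A (B y) = A (B (J y + N (J y)))" by (simp add: J2)
    also have "\<dots> = A (B (J y)) + N (A (B (J y)))" by (simp add: blinfun.add_right NAB ABN)
    finally show ?thesis by (simp add: J1)
  qed
  have "local_inverse X (B o\<^sub>L J)"
    unfolding local_inverse_def
  proof (intro conjI allI)
    show "B (A ((B o\<^sub>L J) y)) = (B o\<^sub>L J) y" for y by simp
    show "(B o\<^sub>L J) (A (B y)) = (B o\<^sub>L J) y" for y by (simp flip: comm)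
    show "A (B (X ((B o\<^sub>L J) y))) = A (B y)" for y
    proof -
      have "A (B (J y)) + N (J y) = A (B y)"
        using arg_cong[OF J2[of y], of "\<lambda>z. A (B z)"] by (simp add: blinfun.add_right ABN)
      then show ?thesis by (simp add: N)
    qed
    show "(B o\<^sub>L J) (X (B (A x))) = B (A x)" for x
    proof -
      have "B (J (X (B (A x)))) = B (J (A (B (X (B (A x))))))"
        by (metis BAB_apply comm)
      also have "A (B (X (B (A x)))) = A x + N (A x)" by (simp add: N)
      finally show ?thesis by (simp add: J1)
    qed
  qed
  then show ?thesis by blast
qed

definition G where "G X = (THE G. local_inverse X G)"

lemma G_eqI: "local_inverse X K \<Longrightarrow> G X = K"
  unfolding G_def using local_inverse_unique by blast

lemma local_inverse_G: "X \<in> U \<Longrightarrow> local_inverse X (G X)"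
  using local_inverse_exists G_eqI by metis

lemma
  assumes "X \<in> U"
  shows BA_G: "B (A (G X y)) = G X y" and G_AB: "G X (A (B y)) = G X y"
    and AB_X_G: "A (B (X (G X y))) = A (B y)" and G_X_BA: "G X (X (B (A x))) = B (A x)"
  using local_inverse_G[OF assms] by (simp_all add: local_inverse_def)

lemma G_X_G: "X \<in> U \<Longrightarrow> G X (X (G X y)) = G X y"
  using G_X_BA[of X "G X y"] by (simp add: BA_G)

lemma open_U: "open U"
  unfolding U_def by (intro open_Collect_less continuous_intros)

sublocale resolvent_family U G
  using open_U local_inverse_resolvent local_inverse_G by unfold_locales auto

text \<open>Membership in \<open>U\<close> and the value of \<open>G\<close> depend on the block
  \<open>a\<close> alone. The charts and the retraction onto \<open>S\<close> keep this
  block.\<close>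

lemma
  fixes X Y :: "'a \<Rightarrow>\<^sub>L 'b"
  assumes "X \<in> U" and "\<And>x. A (B (Y (B (A x)))) = A (B (X (B (A x))))"
  shows U_cong: "Y \<in> U" and G_cong: "G Y = G X"
proof -
  have "(A o\<^sub>L B o\<^sub>L (Y - A) o\<^sub>L B) = (A o\<^sub>L B o\<^sub>L (X - A) o\<^sub>L B)"
  proof (rule blinfun_eqI)
    fix y
    show "(A o\<^sub>L B o\<^sub>L (Y - A) o\<^sub>L B) y = (A o\<^sub>L B o\<^sub>L (X - A) o\<^sub>L B) y"
      using assms(2)[of "B y"] by (simp add: blinfun.bilinear_simps)
  qed
  then show "Y \<in> U" using assms(1) by (simp add: U_def)
  show "G Y = G X" by (rule G_eqI[OF local_inverse_cong[OF local_inverse_G[OF assms(1)] assms(2)]])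
qed

lemma AB_defect: "X \<in> U \<Longrightarrow> A (B (defect X x)) = 0"
  by (simp add: defect_apply blinfun.diff_right AB_X_G)

lemma defect_BA: "X \<in> U \<Longrightarrow> defect X (B (A x)) = 0"
  by (simp add: defect_apply G_X_BA)

lemma A_in_U: "A \<in> U"
  by (simp add: U_def)

text \<open>An invertible compression of 0 would force \<open>A B = 0\<close> and hence
  \<open>A = A B A = 0\<close>. This keeps \<open>S\<close> inside the nonzero operators.\<close>

lemma zero_notin_U:
  assumes "A \<noteq> 0"
  shows "0 \<notin> U"
proof
  assume "0 \<in> U"
  then have "A (B (0::'b)) = A (B y)" for y
    using AB_X_G[OF \<open>0 \<in> U\<close>, of y] by (simp add: blinfun.bilinear_simps)
  then have "A x = 0" for x using ABA_apply[of x] by (metis blinfun.zero_right)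
  then show False using assms by (auto intro: blinfun_eqI)
qed

definition S where "S = {X \<in> U. defect X = 0}"

lemma S_apply: "X \<in> S \<Longrightarrow> X (G X (X x)) = X x"
  using defect_apply[of X x] by (simp add: S_def)

lemma A_in_S: "A \<in> S"
proof -
  have "defect A x = 0" for x using G_X_BA[OF A_in_U, of x] by (simp add: defect_apply)
  then have "defect A = 0" by (auto intro: blinfun_eqI)
  then show ?thesis by (simp add: S_def A_in_U)
qed

section \<open>The straightening chart\<close>

text \<open>This is the block \<open>d\<close>, from \<open>N(A)\<close> to \<open>N(B)\<close>,
  extended by zero.\<close>

definition corner where
  "corner X = ((id_blinfun - (A o\<^sub>L B)) o\<^sub>L X o\<^sub>L (id_blinfun - (B o\<^sub>L A)))"

lemma corner_apply: "corner X x = X (x - B (A x)) - A (B (X (x - B (A x))))"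
  by (simp add: corner_def blinfun.diff_left)

lemma AB_corner: "A (B (corner X x)) = 0"
  by (simp add: corner_apply blinfun.diff_right)

lemma corner_BA: "corner X (B (A x)) = 0"
  by (simp add: corner_apply)

lemma corner_corner: "corner (corner X) = corner X"
  by (rule blinfun_eqI) (simp add: corner_apply[of "corner X"] AB_corner corner_BA
    blinfun.diff_right)

text \<open>The defect is the Schur complement, which lies entirely in the block
  \<open>d\<close>.\<close>

lemma corner_defect: "X \<in> U \<Longrightarrow> corner (defect X) = defect X"
  by (rule blinfun_eqI) (simp add: corner_apply AB_defect defect_BA blinfun.diff_right)

lemma bounded_linear_corner: "bounded_linear corner"
  unfolding corner_def[abs_def] by (intro bounded_linear_intros)

interpretation corner: bounded_linear corner by (rule bounded_linear_corner)

text \<open>The added term is \<open>s c a^-1 b\<close> in the block \<open>d\<close>. The value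
  \<open>s = -1\<close> produces the Schur complement and \<open>s = 1\<close> undoes it; keeping
  \<open>s\<close> as a parameter treats a chart and its inverse at once.\<close>

definition chart where "chart s X = X + s *\<^sub>R corner (X o\<^sub>L G X o\<^sub>L X)"

text \<open>Smoothness becomes visible: a bounded linear map plus a multiple of
  \<open>defect\<close>.\<close>

lemma chart_eq: "X \<in> U \<Longrightarrow> chart s X = (X + s *\<^sub>R corner X) + - s *\<^sub>R defect X"
proof -
  assume X: "X \<in> U"
  have "corner (X o\<^sub>L G X o\<^sub>L X) = corner X - defect X"
    using corner_defect[OF X] corner.diff[of X "defect X"] by (simp add: defect_def)
  then show ?thesis by (simp add: chart_def scaleR_diff_right)
qed

lemma AB_chart: "A (B (chart s X x)) = A (B (X x))"
  by (simp add: chart_def blinfun.bilinear_simps AB_corner)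

lemma chart_BA: "chart s X (B (A x)) = X (B (A x))"
  by (simp add: chart_def blinfun.bilinear_simps corner_BA)

lemma
  assumes "X \<in> U"
  shows chart_in_U: "chart s X \<in> U" and G_chart: "G (chart s X) = G X"
  by (rule U_cong[OF assms] G_cong[OF assms], simp add: AB_chart chart_BA)+

text \<open>The chart alters only \<open>d\<close>, whereas \<open>X G(X) X\<close> involves only
  \<open>a\<close>, \<open>b\<close> and \<open>c\<close>. So the same term is added and then
  removed.\<close>

lemma chart_chart:
  assumes "X \<in> U"
  shows "chart (- s) (chart s X) = X"
proof -
  have "G X (chart s X x) = G X (X x)" for x using G_AB[OF assms] AB_chart by metis
  moreover have "chart s X (G X y) = X (G X y)" for y using BA_G[OF assms] chart_BA by metis
  ultimately have "(chart s X o\<^sub>L G X o\<^sub>L chart s X) = (X o\<^sub>L G X o\<^sub>L X)"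
    by (intro blinfun_eqI) simp
  then show ?thesis
    unfolding chart_def[of "- s"] G_chart[OF assms] by (simp add: chart_def)
qed

lemma chart_C_infinity: "C_infinity_on U (chart s)"
proof -
  have "bounded_linear (\<lambda>X. X + s *\<^sub>R corner X)"
    by (rule bounded_linear_add[OF bounded_linear_ident
        bounded_linear_const_scaleR[OF bounded_linear_corner]])
  then have "C_infinity_on U (\<lambda>X. X + s *\<^sub>R corner X)"
    by (rule C_infinity_on_bounded_linear[OF open_U])
  moreover have "C_infinity_on U (\<lambda>X. - s *\<^sub>R defect X)"
    by (rule C_infinity_on_compose_left[OF defect_C_infinity bounded_linear_scaleR_right])
  ultimately have "C_infinity_on U (\<lambda>X. X + s *\<^sub>R corner X + - s *\<^sub>R defect X)"
    by (rule C_infinity_on_add)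
  then show ?thesis by (rule C_infinity_on_cong) (simp add: chart_eq)
qed

lemma chart_image_U: "chart s ` U = U"
proof (intro equalityI subsetI)
  show "Y \<in> U" if "Y \<in> chart s ` U" for Y using that chart_in_U by auto
  show "Y \<in> chart s ` U" if "Y \<in> U" for Y
    using chart_chart[OF that, of "- s"] chart_in_U[OF that, of "- s"]
    by (intro image_eqI[of _ _ "chart (- s) Y"]) simp_all
qed

lemma chart_diffeomorphism: "C_infinity_diffeomorphism_on U (chart s)"
proof -
  have inj: "inj_on (chart s) U" by (rule inj_on_inverseI[where g = "chart (- s)"]) (rule
    chart_chart)
  have "chart (- s) Y = inv_into U (chart s) Y" if "Y \<in> U" for Y
    using inv_into_f_f[OF inj chart_in_U[OF that, of "- s"]] chart_chart[OF that, of "- s"] by simp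
  then have "C_infinity_on U (inv_into U (chart s))"
    by (rule C_infinity_on_cong[OF chart_C_infinity])
  then show ?thesis
    by (simp add: C_infinity_diffeomorphism_on_def open_U inj chart_C_infinity chart_image_U)
qed

text \<open>On \<open>U\<close>, \<open>chart (- 1) X = X - corner X + defect X\<close>, and the
  corner of this operator is \<open>defect X\<close>.\<close>

lemma chart_image_S: "chart (- 1) ` S = {X. corner X = 0} \<inter> U"
proof (intro equalityI subsetI)
  fix Y assume "Y \<in> chart (- 1) ` S"
  then obtain X where X: "X \<in> U" "defect X = 0" "Y = chart (- 1) X"
    by (auto simp: S_def)
  then have "Y = X - corner X" by (simp add: chart_eq)
  then have "corner Y = 0" by (simp add: corner.diff corner_corner)
  then show "Y \<in> {X. corner X = 0} \<inter> U" using X(3) chart_in_U[OF X(1)] by simp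
next
  fix Y assume "Y \<in> {X. corner X = 0} \<inter> U"
  then have Y: "Y \<in> U" "corner Y = 0" by auto
  define X where "X = chart 1 Y"
  have X: "X \<in> U" "chart (- 1) X = Y" using Y chart_in_U chart_chart[of Y 1] by (simp_all add:
    X_def)
  have "Y = (X - corner X) + defect X" using X chart_eq[of X "- 1"] by simp
  then have "corner Y = defect X" using corner_defect[OF X(1)] by (simp add: corner.add
    corner.diff corner_corner)
  then have "defect X = 0" using Y by simp
  then show "Y \<in> chart (- 1) ` S" using X by (intro image_eqI[of _ _ X]) (simp_all add: S_def)
qed

text \<open>\<open>corner\<close> is a bounded idempotent, so its kernel is complemented by the set
  of its fixed points.\<close>

lemma closed_complemented_corner: "closed_complemented {X. corner X = 0}"
  unfolding closed_complemented_def is_direct_sum_def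
proof (intro conjI exI[of _ "{X. corner X = X}"])
  have cont: "continuous_on UNIV corner" by (rule bounded_linear.continuous_on[OF
    bounded_linear_corner continuous_on_id])
  show "closed {X. corner X = 0}" "closed {X. corner X = X}"
    by (intro closed_Collect_eq cont continuous_intros)+
  show "subspace {X. corner X = 0}" "subspace {X. corner X = X}"
    by (auto simp: subspace_def corner.zero corner.add corner.scaleR)
  show "{X. corner X = 0} \<inter> {X. corner X = X} = {0}" by (auto simp: corner.zero)
  have "\<exists>Y Z. X = Y + Z \<and> corner Y = 0 \<and> corner Z = Z" for X
    by (rule exI[of _ "X - corner X"], rule exI[of _ "corner X"]) (simp add: corner.diff
      corner_corner)
  then show "{Y + Z |Y Z. Y \<in> {X. corner X = 0} \<and> Z \<in> {X. corner X = X}} = UNIV" by auto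
qed

text \<open>The single chart \<open>chart (- 1)\<close> on \<open>U\<close> serves every point of
  \<open>S\<close>.\<close>

lemma smooth_submanifold_S: "smooth_submanifold S"
  unfolding smooth_submanifold_def
proof (intro ballI exI conjI)
  fix X assume "X \<in> S"
  then show "X \<in> U" by (simp add: S_def)
  have "S \<inter> U = S" by (auto simp: S_def)
  then show "openin (top_of_set {X. corner X = 0}) (chart (- 1) ` (S \<inter> U))"
    by (simp add: chart_image_S openin_open_Int open_U)
qed (rule open_U chart_diffeomorphism closed_complemented_corner)+

section \<open>The tangent spaces\<close>

text \<open>On \<open>S\<close> the operator \<open>rdefect X\<close> maps into
  \<open>kernel X\<close> and fixes it pointwise, while \<open>ldefect X\<close> vanishes exactly on
  the range of \<open>X\<close>.\<close>

lemma M_family_S: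
  assumes "X \<in> S"
  shows "M_family X = {V. (ldefect X o\<^sub>L V o\<^sub>L rdefect X) = 0}"
proof (intro equalityI subsetI)
  fix V assume V: "V \<in> M_family X"
  have "(ldefect X o\<^sub>L V o\<^sub>L rdefect X) x = 0" for x
  proof -
    have "rdefect X x \<in> kernel X"
      using S_apply[OF assms] by (simp add: kernel_def rdefect_apply blinfun.diff_right)
    then obtain z where "V (rdefect X x) = X z" using V unfolding M_family_def by blast
    then show ?thesis using S_apply[OF assms] by (simp add: ldefect_apply)
  qed
  then show "V \<in> {V. (ldefect X o\<^sub>L V o\<^sub>L rdefect X) = 0}" by (auto intro: blinfun_eqI)
next
  fix V assume "V \<in> {V. (ldefect X o\<^sub>L V o\<^sub>L rdefect X) = 0}"
  then have 0: "(ldefect X o\<^sub>L V o\<^sub>L rdefect X) = 0" by simp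
  have V: "ldefect X (V (rdefect X x)) = 0" for x
    using arg_cong[OF 0, of "\<lambda>T. blinfun_apply T x"] by simp
  have "V x \<in> range X" if "X x = 0" for x
  proof (rule range_eqI)
    show "V x = X (G X (V x))" using V[of x] that by (simp add: rdefect_apply ldefect_apply)
  qed
  then show "V \<in> M_family X" by (auto simp: M_family_def kernel_def)
qed

text \<open>Along a curve in \<open>S\<close> the defect is constantly 0, and the chain rule
  computes the same derivative as \<open>ldefect X V rdefect X\<close>.\<close>

lemma tangent_set_S_subset:
  assumes "V \<in> tangent_set S X"
  shows "(ldefect X o\<^sub>L V o\<^sub>L rdefect X) = 0"
proof -
  obtain c r where r: "r > 0" and c: "\<And>t. t \<in> {-r<..<r} \<Longrightarrow> c t \<in> S" "c 0 = X"
    and c': "(c has_vector_derivative V) (at 0)"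
    using assms unfolding tangent_set_def by blast
  have "X \<in> U" using c(1)[of 0] c(2) r by (simp add: S_def)
  then have "(defect has_derivative (\<lambda>H. ldefect X o\<^sub>L H o\<^sub>L rdefect X)) (at (c 0))"
    using defect_has_derivative c(2) by simp
  with c' have "(defect \<circ> c has_derivative (\<lambda>H. ldefect X o\<^sub>L H o\<^sub>L rdefect X) \<circ> (\<lambda>t. t *\<^sub>R V))
    (at 0)"
    unfolding has_vector_derivative_def by (rule diff_chain_at)
  moreover have "(defect \<circ> c has_derivative (\<lambda>_. 0)) (at 0)"
  proof (rule has_derivative_transform_within_open)
    show "((\<lambda>_. 0) has_derivative (\<lambda>_. 0)) (at 0)" by (rule has_derivative_const)
    show "0 = (defect \<circ> c) t" if "t \<in> {-r<..<r}" for t using c(1)[OF that] by (simp add: S_def)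
  qed (use r in auto)
  ultimately have "(\<lambda>H. ldefect X o\<^sub>L H o\<^sub>L rdefect X) \<circ> (\<lambda>t. t *\<^sub>R V) = (\<lambda>_. 0)"
    by (rule has_derivative_unique)
  from fun_cong[OF this, of 1] show ?thesis by simp
qed

text \<open>The map \<open>Z \<mapsto> Z - defect Z = Z G(Z) Z\<close> is a smooth retraction onto \<open>S\<close>.\<close>

lemma retraction_in_S:
  assumes "Z \<in> U"
  shows "Z - defect Z \<in> S"
proof -
  have Y: "(Z - defect Z) x = Z (G Z (Z x))" for x by (simp add: defect_apply blinfun.diff_left)
  \<comment> \<open>The retraction keeps the block \<open>a\<close> and hence \<open>G\<close>.
    Together with \<open>G Z Z G Z = G Z\<close> this makes the defect of \<open>Z G Z Z\<close>
    vanish.\<close>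
  have eq: "A (B ((Z - defect Z) (B (A x)))) = A (B (Z (B (A x))))" for x
    by (simp add: Y AB_X_G[OF assms])
  have "defect (Z - defect Z) = 0"
    by (rule blinfun_eqI) (simp only: defect_apply[of "Z - defect Z"] G_cong[OF assms eq] Y
      G_X_G[OF assms], simp)
  then show ?thesis using U_cong[OF assms eq] by (simp add: S_def)
qed

text \<open>The line \<open>X + t V\<close> is pushed into \<open>S\<close> by the retraction. Its
  image has velocity \<open>V - ldefect X V rdefect X = V\<close> at 0.\<close>

lemma tangent_set_S_supset:
  assumes X: "X \<in> S" and V: "(ldefect X o\<^sub>L V o\<^sub>L rdefect X) = 0"
  shows "V \<in> tangent_set S X"
proof -
  define Z where "Z t = X + t *\<^sub>R V" for t
  have cont: "continuous_on T Z" for T unfolding Z_def by (intro continuous_intros)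
  have "open (Z -` U)" using open_U cont[of UNIV] by (simp add: open_vimage
    continuous_on_eq_continuous_at)
  moreover have "0 \<in> Z -` U" using X by (simp add: Z_def S_def)
  ultimately obtain r where r: "r > 0" "\<And>t. dist t 0 < r \<Longrightarrow> Z t \<in> U"
    unfolding open_dist by (metis vimage_eq)
  have ZU: "Z t \<in> U" if "t \<in> {-r<..<r}" for t using r that by (auto simp: dist_norm)
  define c where "c t = Z t - defect (Z t)" for t
  define c' where "c' t = V - (ldefect (Z t) o\<^sub>L V o\<^sub>L rdefect (Z t))" for t
  have deriv: "(c has_vector_derivative c' t) (at t)" if "t \<in> {-r<..<r}" for t
  proof -
    have Z': "(Z has_derivative (\<lambda>s. s *\<^sub>R V)) (at t)"
      unfolding Z_def by (auto intro!: derivative_eq_intros)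
    have "((\<lambda>t. defect (Z t)) has_derivative (\<lambda>s. ldefect (Z t) o\<^sub>L (s *\<^sub>R V) o\<^sub>L rdefect (Z t)))
      (at t)"
      using diff_chain_at[OF Z' defect_has_derivative[OF ZU[OF that]]] by (simp add: o_def)
    then have "(c has_derivative (\<lambda>s. s *\<^sub>R V - (ldefect (Z t) o\<^sub>L (s *\<^sub>R V) o\<^sub>L rdefect (Z t))))
      (at t)"
      unfolding c_def using Z' by (rule has_derivative_diff[rotated])
    moreover have "s *\<^sub>R V - (ldefect (Z t) o\<^sub>L (s *\<^sub>R V) o\<^sub>L rdefect (Z t)) = s *\<^sub>R c' t" for s
      by (rule blinfun_eqI) (simp add: c'_def blinfun.bilinear_simps scaleR_diff_right)
    ultimately show ?thesis by (simp add: has_vector_derivative_def)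
  qed
  \<comment> \<open>Continuity of both factors makes the velocity \<open>c'\<close> continuous, as a
    \<open>C^1\<close> curve requires.\<close>
  have "continuous_on U ldefect" "continuous_on U rdefect"
    using ldefect_has_derivative rdefect_has_derivative has_derivative_continuous
      continuous_at_imp_continuous_on
    by metis+
  then have "continuous_on {-r<..<r} (\<lambda>t. ldefect (Z t))" "continuous_on {-r<..<r} (\<lambda>t. rdefect (Z
    t))"
    using cont ZU by (auto intro: continuous_on_compose2)
  then have "continuous_on {-r<..<r} c'" unfolding c'_def by (intro continuous_intros)
  then have "c C1_differentiable_on {-r<..<r}"
    unfolding C1_differentiable_on_def using deriv by blast
  moreover have "\<forall>t\<in>{-r<..<r}. c t \<in> S" using retraction_in_S ZU by (simp add: c_def)
  moreover have "c 0 = X" using X by (simp add: c_def Z_def S_def)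
  moreover have "(c has_vector_derivative V) (at 0)"
    using deriv[of 0] V r by (simp add: c'_def Z_def)
  ultimately show ?thesis using r(1) unfolding tangent_set_def by blast
qed

end

theorem theorem4p1:
  fixes A :: "'a::banach \<Rightarrow>\<^sub>L 'b::banach"
  assumes "A \<in> UNIV - {0}"
    and "double_splitting A"
  shows "smooth_integrable_at (UNIV - {0}) M_family A"
proof -
  obtain B where "A o\<^sub>L B o\<^sub>L A = A" "B o\<^sub>L A o\<^sub>L B = B"
    using double_splitting_generalized_inverse[OF assms(2)] by blast
  then interpret generalized_inverse A B by unfold_locales
  have "S \<subseteq> UNIV - {0}" using zero_notin_U assms(1) by (auto simp: S_def)
  moreover have "M_family X = tangent_set S X" if "X \<in> S" for X
    using M_family_S[OF that] tangent_set_S_subset tangent_set_S_supset[OF that] by blast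
  ultimately show ?thesis
    unfolding smooth_integrable_at_def using smooth_submanifold_S A_in_S by blast
qed

end
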